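(* Let $\mathcal{X}=\mathrm{Free}(F_1,F_2,\dots,F_n)$ for finitely many graphs $F_1,\dots,F_n$, and suppose $k_{\mathcal{X}}$ is finite. Then the following are equivalent: (a) the speed of $\mathcal{X}$ is above the Bell number; (b) $\mathcal{X}$ contains a periodic class; (c) for every $p\in\mathbb{N}$, $\mathcal{X}$ contains a cyclic class with period at least $p$; (d) there exist a cyclic word $w$ and a graph $H$ (loops allowed) on the alphabet of $w$ such that $\mathcal{X}$ contains the graph $G_{w,H}(1,2,\dots,2\ell m)$, where $\ell=|V(H)|$ and $m=\max\{|F_i|:1\le i\le n\}$; (e) for any positive integers $\ell,m$, the class $\mathcal{X}$ contains an $(\ell,m)$-strip.
   Context: $\mathrm{Free}(\mathcal{F})$ is the class of finite simple graphs containing no induced subgraph isomorphic to a member of $\mathcal{F}$. Speed $\mathcal{X}_n$: number of graphs in $\mathcal{X}$ on vertex set $\{1,\dots,n\}$; above the Bell number means $\mathcal{X}_n\ge n^{(1-o(1))n}$ (equivalently at least the Bell number $B_n$). Distinguishing number $k_{\mathcal{X}}$: for $X\subseteq V(G)$, disjoint sets $U_1,\dots,U_m$ are distinguished by $X$ if vertices in the same $U_i$ have equal neighbourhoods in $X$ and vertices in different $U_i$ have different neighbourhoods in $X$; $k_{\mathcal{X}}=\infty$ if for all $k,m$ some $G\in\mathcal{X}$ has $X$ distinguishing at least $m$ sets of size $\ge k$; otherwise $k_{\mathcal{X}}$ is the least $k$ such that for some $m$ no vertex subset of any graph in $\mathcal{X}$ distinguishes more than $m$ sets of size $\ge k$.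 Words are maps $w:S\to A$ ($S=\{1,\dots,n\}$ or $\mathbb{N}$, $A$ finite), $w_i=w(i)$. For $H$ with loops allowed on $A$ and positive integers $u_1<\dots<u_m\le|w|$, $G_{w,H}(u_1,\dots,u_m)$ has vertex set $\{u_i\}$ and $u_iu_j$ is an edge iff ($|u_i-u_j|=1$ and $w_{u_i}w_{u_j}\notin E(H)$) or ($|u_i-u_j|>1$ and $w_{u_i}w_{u_j}\in E(H)$) (a loop at $a$ handles equal letters $a$). For infinite $w$, $\mathcal{P}(w,H)$ is the class of graphs isomorphic to some $G_{w,H}(u_1,\dots,u_m)$. An infinite word $w$ is periodic with period $p$ if $w_i=w_{i+p}$ for all $i$; it is cyclic if moreover for some period $p$ the letters $w_1,\dots,w_p$ are pairwise distinct. A class is periodic (cyclic) if it equals $\mathcal{P}(w,H)$ for some graph $H$ with loops allowed and periodic (cyclic) word $w$; a cyclic class has period $p$ if its word does. "$\mathcal{X}$ contains a class" means inclusion. Strip: for $A=\{1,\dots,\ell\}$, $H$ a graph on $A$ with loops allowed and $m\ge1$, $S_{H,m}$ has vertex set $A\times\{1,\dots,m\}$, and distinct $(a,j),(b,k)$ are adjacent iff either $ab\in E(H)$ and ($|a-b|\ne1$ or $j\ne k$), or $ab\notin E(H)$, $|a-b|=1$ and $j=k$. Such a graph is an $(\ell,m)$-strip. *)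

theory Defs
  imports Complex_Main
begin

type_synonym 'v graph = "'v set \<times> ('v \<times> 'v) set"

definition verts :: "'v graph \<Rightarrow> 'v set" where "verts G = fst G"
definition edges :: "'v graph \<Rightarrow> ('v \<times> 'v) set" where "edges G = snd G"

definition simple_graph :: "'v graph \<Rightarrow> bool" where
  "simple_graph G \<longleftrightarrow> finite (verts G) \<and> edges G \<subseteq> verts G \<times> verts G
     \<and> sym (edges G) \<and> irrefl (edges G)"

definition graph_iso :: "'a graph \<Rightarrow> 'b graph \<Rightarrow> bool" where
  "graph_iso G H \<longleftrightarrow> (\<exists>f. bij_betw f (verts G) (verts H) \<and>
     (\<forall>u\<in>verts G. \<forall>v\<in>verts G. (u, v) \<in> edges G \<longleftrightarrow> (f u, f v) \<in> edges H))"

definition induced_sub :: "'a graph \<Rightarrow> 'b graph \<Rightarrow> bool" where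
  "induced_sub F G \<longleftrightarrow> (\<exists>f. inj_on f (verts F) \<and> f ` verts F \<subseteq> verts G \<and>
     (\<forall>u\<in>verts F. \<forall>v\<in>verts F. (u, v) \<in> edges F \<longleftrightarrow> (f u, f v) \<in> edges G))"

text \<open>Graph classes are sets of simple graphs on natural-number vertices
  (every finite graph is isomorphic to such a graph).\<close>
definition Free :: "nat graph list \<Rightarrow> nat graph set" where
  "Free Fs = {G. simple_graph G \<and> (\<forall>F\<in>set Fs. \<not> induced_sub F G)}"

definition contains_graph :: "nat graph set \<Rightarrow> 'v graph \<Rightarrow> bool" where
  "contains_graph X G \<longleftrightarrow> (\<exists>G'\<in>X. graph_iso G G')"

definition speed :: "nat graph set \<Rightarrow> nat \<Rightarrow> nat" where
  "speed X n = card {G \<in> X. verts G = {1..n}}"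

definition above_Bell :: "nat graph set \<Rightarrow> bool" where
  "above_Bell X \<longleftrightarrow> (\<exists>f :: nat \<Rightarrow> real. f \<longlonglongrightarrow> 0 \<and>
     (\<forall>\<^sub>F n in sequentially. real n powr ((1 - f n) * real n) \<le> real (speed X n)))"

definition nbhd_in :: "'v graph \<Rightarrow> 'v set \<Rightarrow> 'v \<Rightarrow> 'v set" where
  "nbhd_in G S x = {s \<in> S. (x, s) \<in> edges G}"

definition distinguishes :: "'v graph \<Rightarrow> 'v set \<Rightarrow> (nat \<Rightarrow> 'v set) \<Rightarrow> nat \<Rightarrow> bool" where
  "distinguishes G S U m \<longleftrightarrow> S \<subseteq> verts G \<and> (\<forall>i<m. U i \<subseteq> verts G)
     \<and> (\<forall>i<m. \<forall>j<m. i \<noteq> j \<longrightarrow> U i \<inter> U j = {})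
     \<and> (\<forall>i<m. \<forall>x\<in>U i. \<forall>y\<in>U i. nbhd_in G S x = nbhd_in G S y)
     \<and> (\<forall>i<m. \<forall>j<m. i \<noteq> j \<longrightarrow> (\<forall>x\<in>U i. \<forall>y\<in>U j. nbhd_in G S x \<noteq> nbhd_in G S y))"

definition k_infinite :: "nat graph set \<Rightarrow> bool" where
  "k_infinite X \<longleftrightarrow> (\<forall>k m. \<exists>G\<in>X. \<exists>S U. distinguishes G S U m \<and> (\<forall>i<m. k \<le> card (U i)))"

text \<open>An infinite word is w :: nat \<Rightarrow> nat, used on positions 1,2,...;
  a graph H with loops allowed on alphabet A is a symmetric relation E \<subseteq> A \<times> A.\<close>

definition word_over :: "nat set \<Rightarrow> (nat \<Rightarrow> nat) \<Rightarrow> bool" where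
  "word_over A w \<longleftrightarrow> finite A \<and> w ` {1..} \<subseteq> A"

definition loop_graph_on :: "nat set \<Rightarrow> (nat \<times> nat) set \<Rightarrow> bool" where
  "loop_graph_on A E \<longleftrightarrow> E \<subseteq> A \<times> A \<and> sym E"

definition has_period :: "(nat \<Rightarrow> nat) \<Rightarrow> nat \<Rightarrow> bool" where
  "has_period w p \<longleftrightarrow> p > 0 \<and> (\<forall>i\<ge>1. w (i + p) = w i)"

definition periodic_word :: "(nat \<Rightarrow> nat) \<Rightarrow> bool" where
  "periodic_word w \<longleftrightarrow> (\<exists>p. has_period w p)"

definition cyclic_with_period :: "(nat \<Rightarrow> nat) \<Rightarrow> nat \<Rightarrow> bool" where
  "cyclic_with_period w p \<longleftrightarrow> has_period w p \<and> inj_on w {1..p}"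

definition GwH :: "(nat \<Rightarrow> nat) \<Rightarrow> (nat \<times> nat) set \<Rightarrow> nat set \<Rightarrow> nat graph" where
  "GwH w E U = (U, {(u, v). u \<in> U \<and> v \<in> U \<and> u \<noteq> v \<and>
      (((u = Suc v \<or> v = Suc u) \<and> (w u, w v) \<notin> E) \<or>
       (\<not> (u = Suc v \<or> v = Suc u) \<and> (w u, w v) \<in> E))})"

definition Pclass :: "(nat \<Rightarrow> nat) \<Rightarrow> (nat \<times> nat) set \<Rightarrow> nat graph set" where
  "Pclass w E = {G. simple_graph G \<and>
     (\<exists>U. finite U \<and> U \<subseteq> {1..} \<and> graph_iso (GwH w E U) G)}"

definition strip :: "nat \<Rightarrow> (nat \<times> nat) set \<Rightarrow> nat \<Rightarrow> (nat \<times> nat) graph" where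
  "strip l E m = ({1..l} \<times> {1..m},
     {((a, j), (b, k)). a \<in> {1..l} \<and> b \<in> {1..l} \<and> j \<in> {1..m} \<and> k \<in> {1..m} \<and>
        (a, j) \<noteq> (b, k) \<and>
        (((a, b) \<in> E \<and> (\<not> (a = Suc b \<or> b = Suc a) \<or> j \<noteq> k)) \<or>
         ((a, b) \<notin> E \<and> (a = Suc b \<or> b = Suc a) \<and> j = k))})"

end

theory Submission
  imports Defs "HOL-Combinatorics.Permutations" "HOL-Real_Asymp.Real_Asymp"
begin

text \<open>
  Relabelling the positions of a periodic word modulo a large multiple of its period turns it into a
  cyclic word without changing the class. Conversely a forbidden graph meets only \<open>m\<close> positions
  of a word, whose maximal runs can be shifted together inside a prefix of length \<open>2 l m\<close>. Blocks
  of a cyclic word taken far apart form strips.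

  Bounded distinguishing number means that the relation of a long strip has boundedly many different
  rows, so a strip is a word over a bounded alphabet; two equal windows of length \<open>m\<close> in it give a
  periodic word all of whose short factors occur in the strip.

  For the speed, labelling a strip with \<open>L\<close> letters amounts to choosing \<open>L - 1\<close> matchings of
  \<open>n / L\<close> points, which gives \<open>n powr ((1 - 1 / L - o(1)) n)\<close> graphs. In the other direction, a set of
  vertices splitting off a maximal number of large neighbourhood classes shows that, up to boundedly
  many vertices, every graph of the class is determined by a bounded colouring, a relation on the
  colours and a ``flip'' graph of bounded degree. A large component of the flip graph contains a
  long induced path, in which the pigeonhole principle finds many disjoint copies of one word, that is,
  a strip. Otherwise all components have size at most some \<open>B\<close>, and
  there are at most \<open>n powr ((1 - 1 / B + o(1)) n)\<close> graphs.
\<close>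

section \<open>Hereditary classes and words\<close>

lemma induced_sub_trans:
  assumes "induced_sub F G" "induced_sub G H"
  shows "induced_sub F H"
proof -
  from assms(1) obtain f where f: "inj_on f (verts F)" "f ` verts F \<subseteq> verts G"
    "\<And>u v. u \<in> verts F \<Longrightarrow> v \<in> verts F \<Longrightarrow> (u, v) \<in> edges F \<longleftrightarrow> (f u, f v) \<in> edges G"
    unfolding induced_sub_def by blast
  from assms(2) obtain g where g: "inj_on g (verts G)" "g ` verts G \<subseteq> verts H"
    "\<And>u v. u \<in> verts G \<Longrightarrow> v \<in> verts G \<Longrightarrow> (u, v) \<in> edges G \<longleftrightarrow> (g u, g v) \<in> edges H"
    unfolding induced_sub_def by blast
  have "inj_on (g \<circ> f) (verts F)"
    using f g by (meson comp_inj_on inj_on_subset)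
  moreover have "(g \<circ> f) ` verts F \<subseteq> verts H"
    using f g by fastforce
  moreover have "(u, v) \<in> edges F \<longleftrightarrow> ((g \<circ> f) u, (g \<circ> f) v) \<in> edges H"
    if "u \<in> verts F" "v \<in> verts F" for u v
    using f g that by (simp add: image_subset_iff)
  ultimately show ?thesis
    unfolding induced_sub_def by blast
qed

lemma graph_iso_imp_induced_sub: "graph_iso G H \<Longrightarrow> induced_sub G H"
  unfolding graph_iso_def induced_sub_def bij_betw_def by blast

lemma graph_iso_sym:
  assumes "graph_iso G H"
  shows "graph_iso H G"
proof -
  from assms obtain f where f: "bij_betw f (verts G) (verts H)"
    "\<And>u v. u \<in> verts G \<Longrightarrow> v \<in> verts G \<Longrightarrow> (u, v) \<in> edges G \<longleftrightarrow> (f u, f v) \<in> edges H"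
    unfolding graph_iso_def by blast
  let ?g = "the_inv_into (verts G) f"
  have "bij_betw ?g (verts H) (verts G)"
    using f(1) by (rule bij_betw_the_inv_into)
  moreover have "(u, v) \<in> edges H \<longleftrightarrow> (?g u, ?g v) \<in> edges G" if "u \<in> verts H" "v \<in> verts H" for u v
    using that f(2)[of "?g u" "?g v"] bij_betw_apply[OF calculation]
      f_the_inv_into_f_bij_betw[OF f(1)] by simp
  ultimately show ?thesis
    unfolding graph_iso_def by blast
qed

lemma Free_hereditary:
  assumes "G \<in> Free Fs" "simple_graph H" "induced_sub H G"
  shows "H \<in> Free Fs"
  using assms induced_sub_trans unfolding Free_def by blast

text \<open>The image of an embedding induces a graph that stays in the class by heredity.
  Containment up to isomorphism can therefore be proved by constructing an embedding into some
  member.\<close>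

lemma contains_graph_Free_iff: "contains_graph (Free Fs) H \<longleftrightarrow> (\<exists>G\<in>Free Fs. induced_sub H G)"
proof
  assume "contains_graph (Free Fs) H"
  then show "\<exists>G\<in>Free Fs. induced_sub H G"
    unfolding contains_graph_def using graph_iso_imp_induced_sub by blast
next
  assume "\<exists>G\<in>Free Fs. induced_sub H G"
  then obtain G where G: "G \<in> Free Fs" and sub: "induced_sub H G"
    by blast
  from sub obtain f where f: "inj_on f (verts H)" "f ` verts H \<subseteq> verts G"
    "\<And>u v. u \<in> verts H \<Longrightarrow> v \<in> verts H \<Longrightarrow> (u, v) \<in> edges H \<longleftrightarrow> (f u, f v) \<in> edges G"
    unfolding induced_sub_def by blast
  define V where "V = f ` verts H"
  define G' where "G' = (V, edges G \<inter> V \<times> V)"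
  have sG: "simple_graph G"
    using G by (simp add: Free_def)
  have V: "V \<subseteq> verts G"
    using f by (simp add: V_def)
  have "simple_graph G'"
    using sG finite_subset[OF V] unfolding simple_graph_def G'_def verts_def edges_def sym_def irrefl_def
    by auto
  moreover have "induced_sub G' G"
    unfolding induced_sub_def using V
    by (intro exI[of _ id]) (auto simp: G'_def verts_def edges_def)
  ultimately have "G' \<in> Free Fs"
    using Free_hereditary G by blast
  moreover have "graph_iso H G'"
    unfolding graph_iso_def using f
    by (intro exI[of _ f]) (auto simp: G'_def verts_def edges_def bij_betw_def V_def)
  ultimately show "contains_graph (Free Fs) H"
    unfolding contains_graph_def by blast
qed

section \<open>Adjacency in word graphs and strips\<close>

definition consecutive :: "nat \<Rightarrow> nat \<Rightarrow> bool" where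
  "consecutive i j \<longleftrightarrow> i = Suc j \<or> j = Suc i"

lemma consecutive_commute: "consecutive i j \<longleftrightarrow> consecutive j i"
  by (auto simp: consecutive_def)

lemma verts_GwH [simp]: "verts (GwH w E U) = U"
  by (simp add: GwH_def verts_def)

text \<open>The two cases of the definition collapse into one exclusive or: being consecutive flips
  the adjacency given by \<open>E\<close>. Embeddings of word graphs are checked in this
  form.\<close>

lemma edges_GwH:
  "(u, v) \<in> edges (GwH w E U) \<longleftrightarrow> u \<in> U \<and> v \<in> U \<and> u \<noteq> v \<and> ((w u, w v) \<in> E) \<noteq> consecutive u v"
  by (auto simp: GwH_def edges_def consecutive_def)

lemma verts_strip [simp]: "verts (strip l E m) = {1..l} \<times> {1..m}"
  by (simp add: strip_def verts_def)

lemma edges_strip: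
  "((a, j), (b, k)) \<in> edges (strip l E m) \<longleftrightarrow> a \<in> {1..l} \<and> b \<in> {1..l} \<and> j \<in> {1..m} \<and> k \<in> {1..m}
     \<and> (a, j) \<noteq> (b, k) \<and> ((a, b) \<in> E) \<noteq> (consecutive a b \<and> j = k)"
  by (auto simp: strip_def edges_def consecutive_def)

lemma simple_graph_GwH:
  assumes "finite U" "loop_graph_on A E"
  shows "simple_graph (GwH w E U)"
  using assms
  by (auto simp: simple_graph_def edges_GwH irrefl_def sym_def loop_graph_on_def consecutive_commute)

lemma GwH_in_Pclass:
  assumes "finite U" "U \<subseteq> {1..}" "loop_graph_on A E"
  shows "GwH w E U \<in> Pclass w E"
  unfolding Pclass_def graph_iso_def
  using assms simple_graph_GwH[OF assms(1,3)]
  by (auto intro!: exI[of _ U] exI[of _ id])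

text \<open>A forbidden graph embedded in a word graph occupies only as many positions as it has
  vertices, so testing small position sets suffices. The inserted 0 gives the maximum a value for
  the empty list.\<close>

lemma Pclass_subset_FreeI:
  assumes emb: "\<And>U. finite U \<Longrightarrow> U \<subseteq> {1..} \<Longrightarrow> card U \<le> Max (insert 0 ((\<lambda>F. card (verts F)) ` set Fs))
      \<Longrightarrow> \<exists>G\<in>Free Fs. induced_sub (GwH w E U) G"
  shows "Pclass w E \<subseteq> Free Fs"
proof
  fix G assume G: "G \<in> Pclass w E"
  have "\<not> induced_sub F G" if F: "F \<in> set Fs" for F
  proof
    assume "induced_sub F G"
    moreover obtain U where U: "finite U" "U \<subseteq> {1..}" "graph_iso (GwH w E U) G"
      using G unfolding Pclass_def by blast
    ultimately have sub: "induced_sub F (GwH w E U)"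
      using graph_iso_sym graph_iso_imp_induced_sub induced_sub_trans by blast
    from sub obtain f where f: "inj_on f (verts F)" "f ` verts F \<subseteq> U"
      "\<And>u v. u \<in> verts F \<Longrightarrow> v \<in> verts F \<Longrightarrow> (u, v) \<in> edges F \<longleftrightarrow> (f u, f v) \<in> edges (GwH w E U)"
      unfolding induced_sub_def verts_GwH by blast
    let ?U = "f ` verts F"
    have "induced_sub F (GwH w E ?U)"
      unfolding induced_sub_def using f by (intro exI[of _ f]) (auto simp: edges_GwH)
    moreover have "card ?U \<le> Max (insert 0 ((\<lambda>F. card (verts F)) ` set Fs))"
      using F f(1) by (simp add: card_image)
    then obtain G' where G': "G' \<in> Free Fs" "induced_sub (GwH w E ?U) G'"
      using emb[of ?U] U f(2) finite_subset by (metis subset_trans)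
    ultimately have "induced_sub F G'"
      using induced_sub_trans by blast
    then show False
      using G'(1) F by (simp add: Free_def)
  qed
  then show "G \<in> Free Fs"
    using G by (simp add: Free_def Pclass_def)
qed

section \<open>Periodic words, cyclic words and long prefixes\<close>

lemma has_period_mult: "has_period w p \<Longrightarrow> i \<ge> 1 \<Longrightarrow> w (i + k * p) = w i"
  by (induction k) (auto simp: has_period_def add.assoc[symmetric] add.commute[of p])

lemma has_period_cong:
  assumes "has_period w p" "i \<ge> 1" "j \<ge> 1" "i mod p = j mod p"
  shows "w i = w j"
  using assms
proof (induction i j rule: linorder_wlog)
  case (le a b)
  then obtain k where "b = a + k * p"
    using mod_eq_iff_dvd_symdiff_nat[of a p b]
    by (metis dvd_div_mult_self le_add_diff_inverse mod_eq_dvd_iff_nat)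
  then show ?case
    using le has_period_mult[of w p a k] by simp
qed (metis)

text \<open>The letters are replaced by residues modulo a multiple \<open>q\<close> of the period,
  so that \<open>q\<close> successive positions carry distinct letters, and the relation is pulled
  back along the old word. No adjacency changes, and \<open>q\<close> can be made as large as
  desired.\<close>

lemma periodic_imp_cyclic:
  assumes "loop_graph_on A E" "periodic_word w" "Pclass w E \<subseteq> X"
  shows "\<exists>A E w q. word_over A w \<and> loop_graph_on A E \<and> cyclic_with_period w q \<and> q \<ge> p \<and> Pclass w E \<subseteq> X"
proof -
  obtain p0 where p0: "has_period w p0"
    using assms(2) by (auto simp: periodic_word_def)
  define q where "q = p0 * Suc p"
  have "p0 \<ge> 1"
    using p0 by (simp add: has_period_def)
  then have q: "q > 0" "q \<ge> p"
    using mult_le_mono1[of 1 p0 "Suc p"] by (auto simp: q_def)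
  \<comment> \<open>Positions start at 1; the shift lets residue \<open>a\<close> stand for the
    position \<open>Suc a\<close>, which is never 0.\<close>
  define v where "v i = (i - 1) mod q" for i :: nat
  define E' where "E' = {(a, b). a < q \<and> b < q \<and> (w (Suc a), w (Suc b)) \<in> E}"
  have wv: "w (Suc (v i)) = w i" if "i \<ge> 1" for i
  proof (rule has_period_cong[OF p0])
    have "Suc (v i) mod q = i mod q"
      using that by (simp add: v_def mod_Suc_eq)
    then show "Suc (v i) mod p0 = i mod p0"
      unfolding q_def by (metis mod_mod_cancel dvd_triv_left)
  qed (use that in auto)
  have vq: "v i < q" for i
    using q by (simp add: v_def)
  have edge: "(v i, v j) \<in> E' \<longleftrightarrow> (w i, w j) \<in> E" if "i \<ge> 1" "j \<ge> 1" for i j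
    using wv that vq by (simp add: E'_def)
  have "GwH v E' U = GwH w E U" if "U \<subseteq> {1..}" for U
    using that edge unfolding GwH_def by (auto simp: subset_iff)
  then have "Pclass v E' = Pclass w E"
    unfolding Pclass_def by (metis (no_types, lifting))
  moreover have "word_over {..<q} v"
    using vq by (auto simp: word_over_def)
  moreover have "loop_graph_on {..<q} E'"
    using assms(1) by (auto simp: loop_graph_on_def E'_def sym_def)
  moreover have "has_period v q"
    using q by (auto simp: has_period_def v_def simp flip: Nat.add_diff_assoc2)
  moreover have "inj_on v {1..q}"
    by (rule inj_onI) (auto simp: v_def)
  ultimately show ?thesis
    using q assms(3) unfolding cyclic_with_period_def by metis
qed

text \<open>Maximal runs of consecutive positions are pulled together, keeping residues modulo the period.\<close>

lemma compress_positions: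
  fixes U :: "nat set"
  assumes "finite U" "q > 0"
  shows "\<exists>\<phi>. (\<forall>u\<in>U. 1 \<le> \<phi> u \<and> \<phi> u \<le> 2 * q * card U \<and> \<phi> u mod q = u mod q) \<and>
    (\<forall>u\<in>U. \<forall>v\<in>U. u < v \<longrightarrow> \<phi> u < \<phi> v \<and> (v = Suc u \<longleftrightarrow> \<phi> v = Suc (\<phi> u)))"
  using assms(1)
proof (induction U rule: finite_linorder_max_induct)
  case empty
  then show ?case by simp
next
  case (insert x A)
  obtain \<phi> where \<phi>: "\<And>u. u \<in> A \<Longrightarrow> 1 \<le> \<phi> u \<and> \<phi> u \<le> 2 * q * card A \<and> \<phi> u mod q = u mod q"
    "\<And>u v. u \<in> A \<Longrightarrow> v \<in> A \<Longrightarrow> u < v \<Longrightarrow> \<phi> u < \<phi> v \<and> (v = Suc u \<longleftrightarrow> \<phi> v = Suc (\<phi> u))"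
    using insert.IH by metis
  have x: "x \<notin> A" and card: "card (insert x A) = Suc (card A)"
    using insert by auto
  have next_residue: "\<exists>z. n \<le> z \<and> z < n + q \<and> z mod q = x mod q" for n
  proof -
    \<comment> \<open>The summand \<open>(q - 1) * n\<close> plays the role of \<open>- n\<close>
      modulo \<open>q\<close> and avoids subtraction of natural numbers.\<close>
    let ?z = "n + (x + (q - 1) * n) mod q"
    have "(n + (x + (q - 1) * n)) mod q = (x + q * n) mod q"
      using assms(2) by (cases q) (simp_all add: algebra_simps)
    then have "?z mod q = x mod q"
      by (simp add: mod_add_right_eq)
    then show ?thesis
      using assms(2) by (intro exI[of _ ?z]) auto
  qed
  have "\<exists>z. 1 \<le> z \<and> z \<le> 2 * q * Suc (card A) \<and> z mod q = x mod q \<and>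
      (\<forall>u\<in>A. \<phi> u < z \<and> (x = Suc u \<longleftrightarrow> z = Suc (\<phi> u)))"
  proof (cases "A = {}")
    case True
    obtain z where "1 \<le> z" "z < 1 + q" "z mod q = x mod q"
      using next_residue by blast
    then show ?thesis
      using True by (intro exI[of _ z]) auto
  next
    case False
    define y where "y = Max A"
    have y: "y \<in> A" "\<And>u. u \<in> A \<Longrightarrow> u \<le> y"
      using False insert.hyps by (auto simp: y_def)
    have le: "\<phi> u \<le> \<phi> y" if "u \<in> A" for u
      using \<phi>(2)[OF that y(1)] y(2)[OF that] by (cases "u = y") auto
    have lt: "\<phi> u < \<phi> y" if "u \<in> A" "u \<noteq> y" for u
      using \<phi>(2)[OF that(1) y(1)] y(2)[OF that(1)] that by auto
    have yx: "y < x"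
      using insert.hyps y by blast
    show ?thesis
    proof (cases "x = Suc y")
      case True
      have consec: "x = Suc u \<longleftrightarrow> Suc (\<phi> y) = Suc (\<phi> u)" if "u \<in> A" for u
        using lt[OF that] True by (cases "u = y") auto
      have "\<phi> y mod q = y mod q" "\<phi> y \<le> 2 * q * card A"
        using \<phi>(1) y by auto
      moreover have "Suc (\<phi> y) mod q = x mod q"
        using calculation True by (metis mod_Suc_eq)
      moreover have "1 \<le> 2 * q"
        using assms(2) by simp
      ultimately show ?thesis
        using True le consec by (intro exI[of _ "Suc (\<phi> y)"]) (auto simp: less_Suc_eq_le)
    next
      case False
      \<comment> \<open>Starting at \<open>\<phi> y + 2\<close> keeps the two runs apart. The
        advance is at most \<open>q + 1\<close>, hence at most \<open>2 * q\<close> per point; this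
        is the origin of the factor 2 in the bound.\<close>
      obtain z where z: "\<phi> y + 2 \<le> z" "z < \<phi> y + 2 + q" "z mod q = x mod q"
        using next_residue by blast
      moreover have "\<phi> y \<le> 2 * q * card A"
        using \<phi>(1) y by auto
      ultimately have "z \<le> 2 * q * Suc (card A)"
        using assms(2) by (simp add: algebra_simps)
      then show ?thesis
        using z le y(2) yx False by (intro exI[of _ z]) (fastforce)
    qed
  qed
  then obtain z where z: "1 \<le> z" "z \<le> 2 * q * Suc (card A)" "z mod q = x mod q"
    "\<And>u. u \<in> A \<Longrightarrow> \<phi> u < z \<and> (x = Suc u \<longleftrightarrow> z = Suc (\<phi> u))"
    by blast
  have "2 * q * card A \<le> 2 * q * Suc (card A)"
    by simp
  then have "\<And>u. u \<in> A \<Longrightarrow> \<phi> u \<le> 2 * q * Suc (card A)"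
    using \<phi>(1) le_trans by blast
  then show ?case
    unfolding card using \<phi> z insert.hyps x
    by (intro exI[of _ "\<phi>(x := z)"]) (auto dest: less_asym)
qed

text \<open>Compressed positions are bounded in terms of the period, and distinct letters within a
  period bound the period by the size of the alphabet. So every position set that could carry a
  forbidden graph is realised inside the prefix.\<close>

lemma Pclass_subset_of_long_prefix:
  assumes w: "word_over A w" "loop_graph_on A E" "cyclic_with_period w q"
    and G: "contains_graph (Free Fs)
      (GwH w E {1..2 * card A * Max (insert 0 ((\<lambda>F. card (verts F)) ` set Fs))})"
  shows "Pclass w E \<subseteq> Free Fs"
proof (rule Pclass_subset_FreeI)
  fix U :: "nat set"
  let ?m = "Max (insert 0 ((\<lambda>F. card (verts F)) ` set Fs))"
  assume U: "finite U" "U \<subseteq> {1..}" "card U \<le> ?m"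
  have q: "has_period w q" "q > 0" and inj: "inj_on w {1..q}"
    using w(3) by (auto simp: cyclic_with_period_def has_period_def)
  have "card {1..q} \<le> card A"
    using w(1) by (intro card_inj_on_le[OF inj]) (auto simp: word_over_def)
  then have bound: "2 * q * card U \<le> 2 * card A * ?m"
    using U(3) by (intro mult_le_mono) auto
  obtain \<phi> where \<phi>: "\<And>u. u \<in> U \<Longrightarrow> 1 \<le> \<phi> u \<and> \<phi> u \<le> 2 * q * card U \<and> \<phi> u mod q = u mod q"
    "\<And>u v. u \<in> U \<Longrightarrow> v \<in> U \<Longrightarrow> u < v \<Longrightarrow> \<phi> u < \<phi> v \<and> (v = Suc u \<longleftrightarrow> \<phi> v = Suc (\<phi> u))"
    using compress_positions[OF U(1) q(2)] by blast
  have ne: "\<phi> u \<noteq> \<phi> v \<and> (consecutive (\<phi> u) (\<phi> v) \<longleftrightarrow> consecutive u v)"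
    if "u \<in> U" "v \<in> U" "u \<noteq> v" for u v
    using \<phi>(2)[of u v] \<phi>(2)[of v u] that
    by (cases u v rule: linorder_cases) (auto simp: consecutive_def)
  have w\<phi>: "w (\<phi> u) = w u" if "u \<in> U" for u
    using \<phi>(1)[OF that] U(2) that by (intro has_period_cong[OF q(1)]) auto
  have \<phi>U: "\<phi> u \<in> {1..2 * card A * ?m}" if "u \<in> U" for u
    using \<phi>(1)[OF that] bound by simp
  have "induced_sub (GwH w E U) (GwH w E {1..2 * card A * ?m})"
    unfolding induced_sub_def verts_GwH edges_GwH
  proof (intro exI[of _ \<phi>] conjI ballI)
    show "inj_on \<phi> U"
      using ne by (auto intro: inj_onI)
    show "\<phi> ` U \<subseteq> {1..2 * card A * ?m}"
      using \<phi>U by blast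
  next
    fix u v assume "u \<in> U" "v \<in> U"
    then show "(u \<in> U \<and> v \<in> U \<and> u \<noteq> v \<and> ((w u, w v) \<in> E) \<noteq> consecutive u v) \<longleftrightarrow>
      (\<phi> u \<in> {1..2 * card A * ?m} \<and> \<phi> v \<in> {1..2 * card A * ?m} \<and> \<phi> u \<noteq> \<phi> v \<and>
       ((w (\<phi> u), w (\<phi> v)) \<in> E) \<noteq> consecutive (\<phi> u) (\<phi> v))"
      using \<phi>U w\<phi> ne by metis
  qed
  then show "\<exists>G\<in>Free Fs. induced_sub (GwH w E U) G"
    using G contains_graph_Free_iff induced_sub_trans by blast
qed

lemma strip_in_cyclic_class:
  assumes "loop_graph_on A E" "has_period w q" "l \<le> q" "Pclass w E \<subseteq> Free Fs"
  shows "\<exists>E. loop_graph_on {1..l} E \<and> contains_graph (Free Fs) (strip l E m)"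
proof -
  have q: "q > 0"
    using assms(2) by (simp add: has_period_def)
  define E' where "E' = {(a, b). a \<in> {1..l} \<and> b \<in> {1..l} \<and> (w a, w b) \<in> E}"
  \<comment> \<open>The step between copies is a multiple of the period, so the letters recur. It is
    \<open>2 * q\<close> and not \<open>q\<close> because a copy may fill a whole period, and
    positions of different copies must not be consecutive.\<close>
  define \<phi> where "\<phi> = (\<lambda>(a, j). a + j * (2 * q))"
  define U where "U = \<phi> ` ({1..l} \<times> {1..m})"
  have w\<phi>: "w (\<phi> (a, j)) = w a" if "a \<ge> 1" for a j
    using has_period_mult[OF assms(2) that, of "j * 2"] by (simp add: \<phi>_def mult.assoc)
  have far: "a + j * (2 * q) + 1 < b + k * (2 * q)"
    if "a \<in> {1..l}" "b \<in> {1..l}" "j < k" for a b j k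
  proof -
    have "(j + 1) * (2 * q) \<le> k * (2 * q)"
      using that by (intro mult_le_mono) auto
    then have "j * (2 * q) + 2 * q \<le> k * (2 * q)"
      by (simp add: algebra_simps)
    moreover have "a \<le> q" "b \<ge> 1" "q \<ge> 1"
      using that assms(3) q by auto
    ultimately show ?thesis
      by linarith
  qed
  have \<phi>: "(\<phi> (a, j) = \<phi> (b, k) \<longleftrightarrow> (a, j) = (b, k)) \<and>
      (consecutive (\<phi> (a, j)) (\<phi> (b, k)) \<longleftrightarrow> consecutive a b \<and> j = k)"
    if "a \<in> {1..l}" "b \<in> {1..l}" for a b j k
    using far[of a b j k] far[of b a k j] that
    by (cases j k rule: linorder_cases) (auto simp: \<phi>_def consecutive_def)
  have "induced_sub (strip l E' m) (GwH w E U)"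
    unfolding induced_sub_def verts_strip verts_GwH edges_GwH
  proof (intro exI[of _ \<phi>] conjI ballI)
    show "inj_on \<phi> ({1..l} \<times> {1..m})"
      using \<phi> by (intro inj_onI) auto
    show "\<phi> ` ({1..l} \<times> {1..m}) \<subseteq> U"
      by (simp add: U_def)
  next
    fix x y assume xy: "x \<in> {1..l} \<times> {1..m}" "y \<in> {1..l} \<times> {1..m}"
    obtain a j b k where eq: "x = (a, j)" "y = (b, k)"
      by fastforce
    have "\<phi> x \<in> U" "\<phi> y \<in> U"
      using xy by (auto simp: U_def)
    moreover have "w (\<phi> x) = w a" "w (\<phi> y) = w b"
      using w\<phi> xy eq by auto
    ultimately show "(x, y) \<in> edges (strip l E' m) \<longleftrightarrow>
      (\<phi> x \<in> U \<and> \<phi> y \<in> U \<and> \<phi> x \<noteq> \<phi> y \<and> ((w (\<phi> x), w (\<phi> y)) \<in> E) \<noteq> consecutive (\<phi> x) (\<phi> y))"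
      using xy \<phi>[of a b j k] unfolding eq edges_strip by (auto simp: E'_def)
  qed
  moreover have "GwH w E U \<in> Free Fs"
  proof -
    have "U \<subseteq> {1..}"
      by (auto simp: U_def \<phi>_def)
    then show ?thesis
      using GwH_in_Pclass[of U A E w] assms by (auto simp: U_def)
  qed
  moreover have "loop_graph_on {1..l} E'"
    using assms(1) by (auto simp: loop_graph_on_def E'_def sym_def)
  ultimately show ?thesis
    using contains_graph_Free_iff by blast
qed

section \<open>Long strips yield a periodic class\<close>

text \<open>This is the form in which finiteness of the distinguishing number is applied. Passing to
  \<open>Suc k\<close> makes the threshold positive at no loss.\<close>

lemma k_finite_bound:
  assumes "\<not> k_infinite X"
  obtains k M where "k > 0" "\<And>G S U. G \<in> X \<Longrightarrow> distinguishes G S U M \<Longrightarrow> \<exists>i<M. card (U i) < k"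
proof -
  from assms obtain k M where
    kM: "\<forall>G\<in>X. \<forall>S U. distinguishes G S U M \<longrightarrow> (\<exists>i<M. card (U i) < k)"
    by (auto simp: k_infinite_def not_le)
  show thesis
  proof (rule that[of "Suc k" M])
    fix G S U assume "G \<in> X" "distinguishes G S U M"
    with kM have "\<exists>i<M. card (U i) < k"
      by blast
    then show "\<exists>i<M. card (U i) < Suc k"
      using less_SucI by blast
  qed simp
qed

text \<open>An embedding preserves neighbourhoods inside its image, so images of the sets work. This
  carries a configuration from a strip, whose vertices are pairs, to a member of the class.\<close>

lemma distinguishes_induced_sub:
  assumes "distinguishes H S U M" "induced_sub H G"
  shows "\<exists>S' U'. distinguishes G S' U' M \<and> (\<forall>i<M. card (U' i) = card (U i))"
proof -
  from assms(2) obtain f where f: "inj_on f (verts H)" "f ` verts H \<subseteq> verts G"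
    "\<And>u v. u \<in> verts H \<Longrightarrow> v \<in> verts H \<Longrightarrow> (u, v) \<in> edges H \<longleftrightarrow> (f u, f v) \<in> edges G"
    unfolding induced_sub_def by blast
  have S: "S \<subseteq> verts H" and U: "\<forall>i<M. U i \<subseteq> verts H"
    and disj: "\<forall>i<M. \<forall>j<M. i \<noteq> j \<longrightarrow> U i \<inter> U j = {}"
    and same: "\<forall>i<M. \<forall>x\<in>U i. \<forall>y\<in>U i. nbhd_in H S x = nbhd_in H S y"
    and diff: "\<forall>i<M. \<forall>j<M. i \<noteq> j \<longrightarrow> (\<forall>x\<in>U i. \<forall>y\<in>U j. nbhd_in H S x \<noteq> nbhd_in H S y)"
    using assms(1) unfolding distinguishes_def by - (elim conjE, assumption)+
  note U = U[rule_format]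
  have nbhd: "nbhd_in G (f ` S) (f x) = f ` nbhd_in H S x" if "x \<in> verts H" for x
    using f(3)[OF that] S by (auto simp: nbhd_in_def)
  have sub: "nbhd_in H S x \<subseteq> verts H" for x
    using S by (auto simp: nbhd_in_def)
  have "distinguishes G (f ` S) (\<lambda>i. f ` U i) M"
    unfolding distinguishes_def
  proof (intro conjI allI impI ballI)
    show "f ` S \<subseteq> verts G"
      using S f(2) by blast
    show "f ` U i \<subseteq> verts G" if "i < M" for i
      using U[OF that] f(2) by blast
    show "f ` U i \<inter> f ` U j = {}" if "i < M" "j < M" "i \<noteq> j" for i j
      using disj[rule_format, OF that] inj_on_image_Int[OF f(1) U[OF that(1)] U[OF that(2)]] by simp
    show "nbhd_in G (f ` S) x = nbhd_in G (f ` S) y" if "i < M" "x \<in> f ` U i" "y \<in> f ` U i" for i x y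
    proof -
      obtain x' y' where x: "x = f x'" "x' \<in> U i" and y: "y = f y'" "y' \<in> U i"
        using \<open>x \<in> f ` U i\<close> \<open>y \<in> f ` U i\<close> by blast
      have "x' \<in> verts H" "y' \<in> verts H"
        using x(2) y(2) U[OF that(1)] by auto
      with x y show ?thesis
        using same[rule_format, OF that(1) x(2) y(2)] by (simp add: nbhd)
    qed
    show "nbhd_in G (f ` S) x \<noteq> nbhd_in G (f ` S) y"
      if "i < M" "j < M" "i \<noteq> j" "x \<in> f ` U i" "y \<in> f ` U j" for i j x y
    proof -
      obtain x' y' where x: "x = f x'" "x' \<in> U i" and y: "y = f y'" "y' \<in> U j"
        using \<open>x \<in> f ` U i\<close> \<open>y \<in> f ` U j\<close> by blast
      have "x' \<in> verts H" "y' \<in> verts H"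
        using x(2) y(2) U that by auto
      with x y show ?thesis
        using diff[rule_format, OF that(1-3) x(2) y(2)]
        by (simp add: nbhd inj_on_image_eq_iff[OF f(1) sub sub])
    qed
  qed
  moreover have "card (f ` U i) = card (U i)" if "i < M" for i
    using U[OF that] f(1) by (meson card_image inj_on_subset)
  ultimately show ?thesis
    by blast
qed

text \<open>Letters with different rows are told apart by the first copy of the strip, and each
  letter recurs in the other \<open>m - 1 \<ge> k\<close> copies. So \<open>M\<close> different rows
  would give \<open>M\<close> distinguished sets of size at least \<open>k\<close>.\<close>

lemma card_rows_strip:
  assumes k: "k > 0" "\<And>G S U. G \<in> Free Fs \<Longrightarrow> distinguishes G S U M \<Longrightarrow> \<exists>i<M. card (U i) < k"
    and strip: "contains_graph (Free Fs) (strip l E m)" "m > k"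
  shows "card ((\<lambda>a. {b \<in> {1..l}. (a, b) \<in> E}) ` {1..l}) < M"
proof (rule ccontr)
  define row where "row a = {b \<in> {1..l}. (a, b) \<in> E}" for a
  assume "\<not> ?thesis"
  then have "M \<le> card (row ` {1..l})"
    by (simp add: row_def)
  then obtain R where R: "R \<subseteq> row ` {1..l}" "card R = M"
    by (rule obtain_subset_with_card_n)
  obtain L where L: "L \<subseteq> {1..l}" "inj_on row L" "R = row ` L"
    using R(1) unfolding subset_image_inj by (elim exE conjE) (rule that)
  have "card L = M"
    using L R(2) by (simp add: card_image)
  then obtain h where h: "bij_betw h {0..<M} L"
    using ex_bij_betw_nat_finite[of L] L(1) finite_subset by blast
  have hL: "h i \<in> L" if "i < M" for i
    using bij_betw_apply[OF h, of i] that by simp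
  have hl: "h i \<in> {1..l}" if "i < M" for i
    using hL[OF that] L(1) by blast
  have row: "row (h i) \<noteq> row (h j)" if "i < M" "j < M" "i \<noteq> j" for i j
    using inj_onD[OF L(2) _ hL hL, of i j] inj_onD[OF bij_betw_imp_inj_on[OF h], of i j] that by auto
  define S where "S = {1..l} \<times> {1::nat}"
  \<comment> \<open>The first copy is left out because inside it the exceptional adjacency of
    neighbouring letters would disturb the rows.\<close>
  define U where "U i = {h i} \<times> {2..m}" for i
  have nbhd: "nbhd_in (strip l E m) S (h i, j) = row (h i) \<times> {1}" if "i < M" "j \<in> {2..m}" for i j
    using hl[OF that(1)] that(2) by (auto simp: nbhd_in_def S_def edges_strip row_def)
  have "distinguishes (strip l E m) S U M"
    unfolding distinguishes_def
  proof (intro conjI allI impI ballI)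
    show "S \<subseteq> verts (strip l E m)"
      using strip(2) by (auto simp: S_def)
    show "U i \<subseteq> verts (strip l E m)" if "i < M" for i
      using hl[OF that] by (auto simp: U_def)
    show "U i \<inter> U j = {}" if "i < M" "j < M" "i \<noteq> j" for i j
      using row[OF that] by (auto simp: U_def)
    show "nbhd_in (strip l E m) S x = nbhd_in (strip l E m) S y" if "i < M" "x \<in> U i" "y \<in> U i" for i x y
    proof -
      obtain j j' where "x = (h i, j)" "j \<in> {2..m}" "y = (h i, j')" "j' \<in> {2..m}"
        using \<open>x \<in> U i\<close> \<open>y \<in> U i\<close> unfolding U_def by blast
      then show ?thesis
        using nbhd[OF that(1)] by simp
    qed
    show "nbhd_in (strip l E m) S x \<noteq> nbhd_in (strip l E m) S y"
      if "i < M" "j < M" "i \<noteq> j" "x \<in> U i" "y \<in> U j" for i j x y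
    proof -
      obtain t t' where t: "x = (h i, t)" "t \<in> {2..m}" "y = (h j, t')" "t' \<in> {2..m}"
        using \<open>x \<in> U i\<close> \<open>y \<in> U j\<close> unfolding U_def by blast
      have "row (h i) \<times> {1::nat} \<noteq> row (h j) \<times> {1}"
        using row[OF that(1-3)] by blast
      then show ?thesis
        unfolding t(1,3) nbhd[OF that(1) t(2)] nbhd[OF that(2) t(4)] .
    qed
  qed
  moreover obtain G where G: "G \<in> Free Fs" "induced_sub (strip l E m) G"
    using strip(1) contains_graph_Free_iff by blast
  ultimately obtain S' U' where "distinguishes G S' U' M" "\<forall>i<M. card (U' i) = card (U i)"
    using distinguishes_induced_sub by blast
  then obtain i where "card (U i) < k"
    using k(2)[OF G(1)] by metis
  then show False
    using strip(2) by (simp add: U_def)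
qed

section \<open>Repeated windows and the embedding of runs into copies of a strip\<close>

lemma repeated_window:
  fixes c :: "nat \<Rightarrow> 'a"
  assumes "finite C" "\<And>i. c i \<in> C" "card C ^ m < N"
  shows "\<exists>x d. d > 0 \<and> x + d < N \<and> (\<forall>t<m. c (x + t) = c (x + d + t))"
proof -
  let ?win = "\<lambda>x. map (\<lambda>t. c (x + t)) [0..<m]"
  have "?win ` {..<N} \<subseteq> {xs. set xs \<subseteq> C \<and> length xs = m}"
    using assms(2) by auto
  then have "card (?win ` {..<N}) \<le> card {xs. set xs \<subseteq> C \<and> length xs = m}"
    by (rule card_mono[OF finite_lists_length_eq[OF assms(1)]])
  also have "\<dots> = card C ^ m"
    by (rule card_lists_length_eq[OF assms(1)])
  finally have "\<not> inj_on ?win {..<N}"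
    using assms(3) by (intro pigeonhole) simp
  then obtain x y where "x < N" "y < N" "x \<noteq> y" "?win x = ?win y"
    unfolding inj_on_def by auto
  then obtain x y where xy: "x < y" "y < N" "?win x = ?win y"
    by (metis nat_neq_iff)
  have "c (x + t) = c (y + t)" if "t < m" for t
    using xy(3) that by (metis (no_types, lifting) atLeastLessThan_iff map_eq_conv set_upt zero_le)
  then show ?thesis
    using xy by (intro exI[of _ x] exI[of _ "y - x"]) auto
qed

text \<open>Every maximal run of consecutive positions receives a copy index of its own and is placed
  in the window starting at its first residue, where the word is still periodic.\<close>

lemma runs_into_copies:
  fixes U :: "nat set"
  assumes "finite U" "d > 0"
  shows "\<exists>t j. (\<forall>u\<in>U. t u mod d = u mod d \<and> t u < d + card U \<and> 1 \<le> j u \<and> j u \<le> card U) \<and>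
    (\<forall>u\<in>U. \<forall>v\<in>U. u < v \<longrightarrow> j u \<le> j v \<and> (j u = j v \<longrightarrow> t u < t v) \<and>
       (v = Suc u \<longleftrightarrow> j u = j v \<and> t v = Suc (t u)))"
  using assms(1)
proof (induction U rule: finite_linorder_max_induct)
  case empty
  then show ?case by simp
next
  case (insert x A)
  obtain t j where
    tj: "\<forall>u\<in>A. t u mod d = u mod d \<and> t u < d + card A \<and> 1 \<le> j u \<and> j u \<le> card A"
    and lt: "\<forall>u\<in>A. \<forall>v\<in>A. u < v \<longrightarrow> j u \<le> j v \<and> (j u = j v \<longrightarrow> t u < t v) \<and>
       (v = Suc u \<longleftrightarrow> j u = j v \<and> t v = Suc (t u))"
    using insert.IH by (elim exE conjE) (rule that)
  note tj = tj[rule_format] and lt = lt[rule_format]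
  have x: "x \<notin> A" and card: "card (insert x A) = Suc (card A)"
    using insert by auto
  have "\<exists>t' j'. t' mod d = x mod d \<and> t' < d + Suc (card A) \<and> 1 \<le> j' \<and> j' \<le> Suc (card A) \<and>
     (\<forall>u\<in>A. j u \<le> j' \<and> (j u = j' \<longrightarrow> t u < t') \<and> (x = Suc u \<longleftrightarrow> j u = j' \<and> t' = Suc (t u)))"
    (is "\<exists>t' j'. ?P t' j'")
  proof (cases "\<exists>y\<in>A. x = Suc y")
    case True
    then obtain y where y: "y \<in> A" "x = Suc y"
      by blast
    have le: "u < y \<or> u = y" if "u \<in> A" for u
      using insert.hyps that y by force
    have "Suc (t y) mod d = x mod d"
      using tj[OF y(1)] y(2) by (metis mod_Suc_eq)
    moreover have "j u \<le> j y \<and> (j u = j y \<longrightarrow> t u < Suc (t y)) \<and>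
        (x = Suc u \<longleftrightarrow> j u = j y \<and> Suc (t y) = Suc (t u))" if "u \<in> A" for u
      using le[OF that] lt[OF that y(1)] y(2) by auto
    ultimately show ?thesis
      using tj[OF y(1)] by (intro exI[of _ "Suc (t y)"] exI[of _ "j y"]) auto
  next
    case False
    have "x mod d < d"
      using assms(2) by simp
    moreover have "j u \<le> Suc (card A) \<and> (j u = Suc (card A) \<longrightarrow> t u < x mod d) \<and>
        (x = Suc u \<longleftrightarrow> j u = Suc (card A) \<and> x mod d = Suc (t u))" if "u \<in> A" for u
      using tj[OF that] False that by auto
    ultimately have "?P (x mod d) (Suc (card A))"
      by (simp add: trans_less_add1)
    then show ?thesis
      by (intro exI)
  qed
  then obtain t' j' where new: "?P t' j'"
    by (elim exE)
  have old: "t u < d + Suc (card A) \<and> j u \<le> Suc (card A)" if "u \<in> A" for u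
    using tj[OF that] by linarith
  let ?t = "t(x := t')" and ?j = "j(x := j')"
  have "?t u mod d = u mod d \<and> ?t u < d + Suc (card A) \<and> 1 \<le> ?j u \<and> ?j u \<le> Suc (card A)"
    if "u \<in> insert x A" for u
    using new tj[of u] old[of u] that by (cases "u = x") auto
  moreover have "?j u \<le> ?j v \<and> (?j u = ?j v \<longrightarrow> ?t u < ?t v) \<and> (v = Suc u \<longleftrightarrow> ?j u = ?j v \<and> ?t v = Suc (?t u))"
    if "u \<in> insert x A" "v \<in> insert x A" "u < v" for u v
  proof -
    have u: "u \<in> A" "u \<noteq> x"
      using that insert.hyps by auto
    show ?thesis
    proof (cases "v = x")
      case True
      then show ?thesis
        using new u by auto
    next
      case False
      then show ?thesis
        using lt[of u v] u that by auto
    qed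
  qed
  ultimately show ?case
    unfolding card by blast
qed

text \<open>In one long strip, letters with equal rows are identified. Pigeonhole gives two equal
  windows of length \<open>mF\<close>, and the segment between their starts is repeated forever. A
  small position set of the resulting word embeds back into the strip run by run, each run in its
  own copy.\<close>

lemma periodic_class_of_strips:
  assumes kfin: "\<not> k_infinite (Free Fs)"
    and strips: "\<And>l m. l > 0 \<Longrightarrow> m > 0 \<Longrightarrow>
      \<exists>E. loop_graph_on {1..l} E \<and> contains_graph (Free Fs) (strip l E m)"
  shows "\<exists>A E w. word_over A w \<and> loop_graph_on A E \<and> periodic_word w \<and> Pclass w E \<subseteq> Free Fs"
proof -
  define mF where "mF = Max (insert 0 ((\<lambda>F. card (verts F)) ` set Fs))"
  obtain k M where k: "k > 0"
    "\<And>G S U. G \<in> Free Fs \<Longrightarrow> distinguishes G S U M \<Longrightarrow> \<exists>i<M. card (U i) < k"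
    using k_finite_bound[OF kfin] by blast
  \<comment> \<open>\<open>N\<close> exceeds the number of windows of length \<open>mF\<close> over
    fewer than \<open>M\<close> letters, \<open>l\<close> leaves room for a window after each start,
    and \<open>m\<close> is both larger than \<open>k\<close>, as the row bound demands, and large
    enough to give every run a copy.\<close>
  define N where "N = Suc (M ^ mF)"
  define l where "l = N + mF"
  define m where "m = Suc k + mF"
  have "l > 0" "m > 0"
    by (auto simp: l_def N_def m_def)
  then obtain E where E: "loop_graph_on {1..l} E" "contains_graph (Free Fs) (strip l E m)"
    using strips by blast
  define row where "row a = {b \<in> {1..l}. (a, b) \<in> E}" for a
  have rows: "card (row ` {1..l}) < M"
    using card_rows_strip[OF k E(2)] by (simp add: m_def row_def)
  \<comment> \<open>The least letter with a given row is its canonical representative: adjacency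
    under \<open>E\<close> is preserved while fewer than \<open>M\<close> letters remain.\<close>
  define rep where "rep a = (LEAST a'. a' \<in> {1..l} \<and> row a' = row a)" for a
  have rep: "rep a \<in> {1..l} \<and> row (rep a) = row a" if "a \<in> {1..l}" for a
    unfolding rep_def by (rule LeastI[of _ a]) (use that in simp)
  have rep_eq: "rep a = rep b" if "row a = row b" for a b
    unfolding rep_def that ..
  have "rep ` {1..l} = (\<lambda>R. LEAST a'. a' \<in> {1..l} \<and> row a' = R) ` row ` {1..l}"
    by (simp add: rep_def image_image)
  then have "card (rep ` {1..l}) \<le> card (row ` {1..l})"
    by (simp add: card_image_le)
  with rows have card_rep: "card (rep ` {1..l}) < M"
    by (rule le_less_trans[rotated])
  have rep_E: "(rep a, rep b) \<in> E \<longleftrightarrow> (a, b) \<in> E" if "a \<in> {1..l}" "b \<in> {1..l}" for a b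
  proof -
    have "(x, y) \<in> E \<longleftrightarrow> (y, x) \<in> E" for x y
      using E(1) by (auto simp: loop_graph_on_def sym_def)
    moreover have "(x, y) \<in> E \<longleftrightarrow> (rep x, y) \<in> E" if "x \<in> {1..l}" "y \<in> {1..l}" for x y
      using rep[OF that(1)] that unfolding row_def by blast
    ultimately show ?thesis
      using that rep by metis
  qed
  \<comment> \<open>Index \<open>i\<close> stands for the letter \<open>Suc i\<close>; beyond the
    strip a default keeps \<open>c\<close> inside the alphabet.\<close>
  define c where "c i = rep (if i < l then Suc i else 1)" for i
  have c_in: "c i \<in> rep ` {1..l}" for i
    using \<open>l > 0\<close> by (auto simp: c_def)
  have "card (rep ` {1..l}) ^ mF < N"
    using power_mono[of "card (rep ` {1..l})" M mF] card_rep by (simp add: N_def le_imp_less_Suc)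
  then obtain x d where xd: "d > 0" "x + d < N" "\<And>t. t < mF \<Longrightarrow> c (x + t) = c (x + d + t)"
    using repeated_window[of "rep ` {1..l}" c mF N] c_in by auto
  define w where "w i = c (x + i mod d)" for i
  \<comment> \<open>Past the first period, equality of the windows at \<open>x\<close> and
    \<open>x + d\<close> permits a step back by \<open>d\<close>. This works for \<open>mF\<close>
    further positions, as many as a run can need.\<close>
  have w_window: "c (x + t) = w t" if "t < d + mF" for t
    using that
  proof (induction t rule: less_induct)
    case (less t)
    show ?case
    proof (cases "t < d")
      case False
      then have "c (x + t) = c (x + (t - d))"
        using xd(3)[of "t - d"] less.prems by simp
      also have "\<dots> = w (t - d)"
        using less.IH[of "t - d"] less.prems xd(1) False by simp
      also have "\<dots> = w t"
        using False by (simp add: w_def le_mod_geq)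
      finally show ?thesis .
    qed (simp add: w_def)
  qed
  have "Pclass w E \<subseteq> Free Fs"
  proof (rule Pclass_subset_FreeI, fold mF_def)
    fix U :: "nat set"
    assume U: "finite U" "U \<subseteq> {1..}" "card U \<le> mF"
    obtain t j where tj: "\<And>u. u \<in> U \<Longrightarrow> t u mod d = u mod d \<and> t u < d + card U \<and> 1 \<le> j u \<and> j u \<le> card U"
      and lt: "\<And>u v. u \<in> U \<Longrightarrow> v \<in> U \<Longrightarrow> u < v \<Longrightarrow> j u \<le> j v \<and> (j u = j v \<longrightarrow> t u < t v) \<and>
         (v = Suc u \<longleftrightarrow> j u = j v \<and> t v = Suc (t u))"
      using runs_into_copies[OF U(1) xd(1)] by metis
    define \<phi> where "\<phi> u = (Suc (x + t u), j u)" for u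
    have xt: "x + t u < l" if "u \<in> U" for u
      using tj[OF that] xd(2) U(3) by (simp add: l_def)
    have \<phi>: "\<phi> u \<in> {1..l} \<times> {1..m}" if "u \<in> U" for u
      using tj[OF that] xt[OF that] U(3) by (simp add: \<phi>_def m_def)
    have letter: "w u = rep (Suc (x + t u))" if "u \<in> U" for u
    proof -
      have "w u = w (t u)"
        using tj[OF that] by (simp add: w_def)
      also have "\<dots> = c (x + t u)"
        using tj[OF that] U(3) by (intro w_window[symmetric]) simp
      finally show ?thesis
        using xt[OF that] by (simp add: c_def)
    qed
    have E_iff: "(w u, w v) \<in> E \<longleftrightarrow> (Suc (x + t u), Suc (x + t v)) \<in> E" if "u \<in> U" "v \<in> U" for u v
      unfolding letter[OF that(1)] letter[OF that(2)]
      using xt[OF that(1)] xt[OF that(2)] by (intro rep_E) auto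
    have increasing: "\<phi> u \<noteq> \<phi> v \<and>
        (consecutive (Suc (x + t u)) (Suc (x + t v)) \<and> j u = j v \<longleftrightarrow> consecutive u v)"
      if "u \<in> U" "v \<in> U" "u < v" for u v
    proof -
      have "consecutive u v \<longleftrightarrow> v = Suc u"
        using that(3) by (auto simp: consecutive_def)
      moreover have "consecutive (Suc (x + t u)) (Suc (x + t v)) \<longleftrightarrow> t v = Suc (t u)" if "t u < t v"
        using that by (auto simp: consecutive_def)
      ultimately show ?thesis
        using lt[OF that] by (cases "j u = j v") (auto simp: \<phi>_def)
    qed
    have pair: "\<phi> u \<noteq> \<phi> v \<and>
        (consecutive (Suc (x + t u)) (Suc (x + t v)) \<and> j u = j v \<longleftrightarrow> consecutive u v)"
      if "u \<in> U" "v \<in> U" "u \<noteq> v" for u v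
      using increasing[of u v] increasing[of v u] that consecutive_commute
      by (cases u v rule: linorder_cases) (simp_all, metis)
    have "induced_sub (GwH w E U) (strip l E m)"
      unfolding induced_sub_def verts_GwH verts_strip
    proof (intro exI[of _ \<phi>] conjI ballI)
      show "inj_on \<phi> U"
        using pair by (auto intro: inj_onI)
      show "\<phi> ` U \<subseteq> {1..l} \<times> {1..m}"
        using \<phi> by blast
    next
      fix u v assume uv: "u \<in> U" "v \<in> U"
      show "(u, v) \<in> edges (GwH w E U) \<longleftrightarrow> (\<phi> u, \<phi> v) \<in> edges (strip l E m)"
        using \<phi>[OF uv(1)] \<phi>[OF uv(2)] pair[OF uv] E_iff[OF uv] uv
        by (cases "u = v") (auto simp: \<phi>_def edges_GwH edges_strip)
    qed
    then show "\<exists>G\<in>Free Fs. induced_sub (GwH w E U) G"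
      using E(2) contains_graph_Free_iff induced_sub_trans by blast
  qed
  moreover have "c i \<in> {1..l}" for i
    using rep \<open>l > 0\<close> by (simp add: c_def)
  then have "word_over {1..l} w"
    unfolding word_over_def w_def by blast
  moreover have "periodic_word w"
    using xd(1) by (auto simp: periodic_word_def has_period_def w_def)
  ultimately show ?thesis
    using E(1) by blast
qed

section \<open>Strips force many labelled graphs\<close>

text \<open>The error sequence is traded for a fixed \<open>\<epsilon>\<close>: lower bounds can be
  proved for one \<open>\<epsilon>\<close> at a time, and an upper bound need contradict only one of
  them.\<close>

lemma above_Bell_iff:
  "above_Bell X \<longleftrightarrow> (\<forall>\<epsilon>>0. \<forall>\<^sub>F n in sequentially. real n powr ((1 - \<epsilon>) * real n) \<le> real (speed X n))"
proof (intro iffI allI impI)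
  fix \<epsilon> :: real assume "above_Bell X" "\<epsilon> > 0"
  then obtain f where f: "f \<longlonglongrightarrow> 0" "\<forall>\<^sub>F n in sequentially. real n powr ((1 - f n) * real n) \<le> real (speed X n)"
    unfolding above_Bell_def by blast
  have "\<forall>\<^sub>F n in sequentially. f n < \<epsilon>"
    using f(1) \<open>\<epsilon> > 0\<close> by (rule order_tendstoD(2))
  with f(2) eventually_ge_at_top[of "1::nat"]
  show "\<forall>\<^sub>F n in sequentially. real n powr ((1 - \<epsilon>) * real n) \<le> real (speed X n)"
  proof eventually_elim
    case (elim n)
    have "real n powr ((1 - \<epsilon>) * real n) \<le> real n powr ((1 - f n) * real n)"
      using elim by (intro powr_mono mult_right_mono) auto
    with elim(1) show ?case
      by linarith
  qed
next
  assume *: "\<forall>\<epsilon>>0. \<forall>\<^sub>F n in sequentially. real n powr ((1 - \<epsilon>) * real n) \<le> real (speed X n)"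
  \<comment> \<open>This is the least nonnegative loss in the exponent compatible with the speed;
    the maximum with 0 covers speeds above \<open>n\<close> to the power \<open>n\<close>.\<close>
  define f where "f n = max 0 (1 - ln (real (speed X n)) / (real n * ln (real n)))" for n
  \<comment> \<open>The instance with \<open>\<epsilon>\<close> equal to 1 makes the speed at least
    1, so that its logarithm can be used.\<close>
  have pos: "\<forall>\<^sub>F n in sequentially. n \<ge> 2 \<and> speed X n \<ge> 1"
    using *[rule_format, OF zero_less_one] eventually_ge_at_top[of "2::nat"]
    by eventually_elim auto
  have "f \<longlonglongrightarrow> 0"
  proof (rule tendstoI)
    fix e :: real assume e: "e > 0"
    have "\<forall>\<^sub>F n in sequentially. real n powr ((1 - e / 2) * real n) \<le> real (speed X n)"
      using * e by (metis half_gt_zero)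
    with pos show "\<forall>\<^sub>F n in sequentially. dist (f n) 0 < e"
    proof eventually_elim
      case (elim n)
      have n: "real n * ln (real n) > 0"
        using elim by simp
      have "(1 - e / 2) * (real n * ln (real n)) = ln (real n powr ((1 - e / 2) * real n))"
        using elim by simp
      also have "\<dots> \<le> ln (real (speed X n))"
        using elim by (subst ln_le_cancel_iff) auto
      finally have "1 - e / 2 \<le> ln (real (speed X n)) / (real n * ln (real n))"
        using n by (simp add: pos_le_divide_eq)
      then show ?case
        using e by (simp add: f_def)
    qed
  qed
  moreover have "\<forall>\<^sub>F n in sequentially. real n powr ((1 - f n) * real n) \<le> real (speed X n)"
    using pos
  proof eventually_elim
    case (elim n)
    have n: "real n * ln (real n) > 0"
      using elim by simp
    have "1 - f n \<le> ln (real (speed X n)) / (real n * ln (real n))"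
      by (simp add: f_def)
    then have "(1 - f n) * (real n * ln (real n)) \<le> ln (real (speed X n))"
      using n by (simp add: pos_le_divide_eq)
    then have "exp ((1 - f n) * (real n * ln (real n))) \<le> exp (ln (real (speed X n)))"
      by simp
    then show ?case
      using elim by (simp add: powr_def mult.assoc)
  qed
  ultimately show "above_Bell X"
    unfolding above_Bell_def by blast
qed

section \<open>Labelled graphs obtained by placing labels on a strip\<close>

lemma simple_graph_strip:
  assumes "loop_graph_on {1..l} E"
  shows "simple_graph (strip l E m)"
proof -
  have E: "(a, b) \<in> E \<longleftrightarrow> (b, a) \<in> E" for a b
    using assms by (auto simp: loop_graph_on_def sym_def)
  have "edges (strip l E m) \<subseteq> ({1..l} \<times> {1..m}) \<times> ({1..l} \<times> {1..m})"
    by (auto simp: edges_strip)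
  moreover have "sym (edges (strip l E m))"
    using E by (auto simp: sym_def edges_strip consecutive_commute)
  ultimately show ?thesis
    by (auto simp: simple_graph_def irrefl_def edges_strip)
qed

lemma pullback_in_Free:
  assumes "G \<in> Free Fs" "induced_sub H G" "simple_graph H" "finite V" "inj_on g V" "g ` V \<subseteq> verts H"
  shows "(V, {(u, v). u \<in> V \<and> v \<in> V \<and> (g u, g v) \<in> edges H}) \<in> Free Fs"
    (is "?P \<in> _")
proof -
  have "induced_sub ?P H"
    unfolding induced_sub_def using assms by (intro exI[of _ g]) (auto simp: verts_def edges_def)
  moreover have "simple_graph ?P"
    using assms(3,4) by (auto simp: simple_graph_def sym_def irrefl_def verts_def edges_def)
  ultimately show ?thesis
    using Free_hereditary[OF assms(1)] induced_sub_trans assms(2) by blast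
qed

lemma finite_speed_set: "finite {G \<in> Free Fs. verts G = {1..n}}"
proof (rule finite_subset)
  show "{G \<in> Free Fs. verts G = {1..n}} \<subseteq> {{1..n}} \<times> Pow ({1..n} \<times> {1..n})"
    by (auto simp: Free_def simple_graph_def verts_def edges_def)
qed simp

text \<open>The first \<open>L * t\<close> labels form \<open>L\<close> blocks of length
  \<open>t\<close>, and block \<open>a\<close> is spread over the copies of letter
  \<open>Suc a\<close> by a permutation. Successive blocks reveal which of their labels share a
  copy, so \<open>L - 1\<close> permutations can be recovered from the graph.\<close>

lemma fact_power_le_speed:
  assumes strip: "loop_graph_on {1..L} E" "contains_graph (Free Fs) (strip L E n)"
    and "L > 0" "n > 0"
  shows "fact (n div L) ^ (L - 1) \<le> speed (Free Fs) n"
proof -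
  define t where "t = n div L"
  have Lt: "L * t \<le> n"
    by (simp add: t_def)
  have tL: "t \<le> L * t"
    using mult_le_mono1[of 1 L t] assms(3) by simp
  have tn: "t \<le> n"
    by (simp add: t_def)
  define P where "P = {p. p permutes {..<t}}"
  define S where "S = (\<Pi>\<^sub>E a\<in>{1..<L}. P)"
  \<comment> \<open>Matchings show only the relative arrangement of the blocks, so the first block
    is normalised to the identity.\<close>
  define \<pi> where "\<pi> \<sigma> a = (if a = 0 then id else \<sigma> a)" for \<sigma> :: "nat \<Rightarrow> nat \<Rightarrow> nat" and a :: nat
  have perm: "\<pi> \<sigma> a permutes {..<t}" if "\<sigma> \<in> S" "a < L" for \<sigma> a
    using that by (auto simp: \<pi>_def S_def P_def)
  \<comment> \<open>The labels left over go to letter 1, in copies after the first \<open>t\<close>,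
    where they meet no block; \<open>n\<close> copies leave enough room.\<close>
  define pos where "pos \<sigma> v = (if v - 1 < L * t then (Suc ((v - 1) div t), Suc (\<pi> \<sigma> ((v - 1) div t) ((v - 1) mod t)))
      else (1, v - L * t + t))" for \<sigma> v
  define G where "G \<sigma> = ({1..n}, {(u, v). u \<in> {1..n} \<and> v \<in> {1..n} \<and> (pos \<sigma> u, pos \<sigma> v) \<in> edges (strip L E n)})" for \<sigma>
  have div: "i div t < L \<and> i mod t < t \<and> t > 0" if "i < L * t" for i
    using that by (cases "t = 0") (auto simp: div_less_iff_less_mult)
  have perm_lt: "\<pi> \<sigma> a j < t" if "\<sigma> \<in> S" "a < L" "j < t" for \<sigma> a j
    using permutes_in_image[OF perm[OF that(1,2)], of j] that(3) by simp
  have pos_range: "pos \<sigma> ` {1..n} \<subseteq> {1..L} \<times> {1..n}" if \<sigma>: "\<sigma> \<in> S" for \<sigma>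
  proof
    fix x assume "x \<in> pos \<sigma> ` {1..n}"
    then obtain v where v: "v \<in> {1..n}" "x = pos \<sigma> v"
      by blast
    show "x \<in> {1..L} \<times> {1..n}"
    proof (cases "v - 1 < L * t")
      case True
      then show ?thesis
        using v div[OF True] perm_lt[OF \<sigma>, of "(v - 1) div t" "(v - 1) mod t"] tn by (auto simp: pos_def)
    next
      case False
      have "v - L * t + t \<le> n"
        using False v(1) tL by (simp only: atLeastAtMost_iff) linarith
      then show ?thesis
        using v False assms(3) by (auto simp: pos_def)
    qed
  qed
  have pos_inj: "inj_on (pos \<sigma>) {1..n}" if \<sigma>: "\<sigma> \<in> S" for \<sigma>
  proof (rule inj_onI)
    fix u v assume uv: "u \<in> {1..n}" "v \<in> {1..n}" "pos \<sigma> u = pos \<sigma> v"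
    have mixed: False if "x \<ge> 1" "y \<ge> 1" "x - 1 < L * t" "\<not> y - 1 < L * t" "pos \<sigma> x = pos \<sigma> y" for x y
      using that div[OF that(3)] perm_lt[OF \<sigma>, of "(x - 1) div t" "(x - 1) mod t"] by (auto simp: pos_def)
    consider "u - 1 < L * t" "v - 1 < L * t" | "\<not> u - 1 < L * t" "\<not> v - 1 < L * t"
      using mixed[of u v] mixed[of v u] uv by fastforce
    then show "u = v"
    proof cases
      case 1
      then have d: "(u - 1) div t = (v - 1) div t"
        and e: "\<pi> \<sigma> ((u - 1) div t) ((u - 1) mod t) = \<pi> \<sigma> ((v - 1) div t) ((v - 1) mod t)"
        using uv(3) by (auto simp: pos_def)
      have "inj (\<pi> \<sigma> ((u - 1) div t))"
        using perm[OF \<sigma>] div[OF 1(1)] permutes_inj by blast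
      with d e have "(u - 1) mod t = (v - 1) mod t"
        by (simp add: inj_eq)
      with d have "u - 1 = v - 1"
        by (metis div_mult_mod_eq)
      then show ?thesis
        using uv(1,2) by auto
    next
      case 2
      then show ?thesis
        using uv by (auto simp: pos_def)
    qed
  qed
  have G_in: "G \<sigma> \<in> {G \<in> Free Fs. verts G = {1..n}}" if \<sigma>: "\<sigma> \<in> S" for \<sigma>
  proof -
    obtain G0 where "G0 \<in> Free Fs" "induced_sub (strip L E n) G0"
      using strip(2) contains_graph_Free_iff by blast
    then have "G \<sigma> \<in> Free Fs"
      unfolding G_def using simple_graph_strip[OF strip(1)] pos_inj[OF \<sigma>] pos_range[OF \<sigma>]
      by (intro pullback_in_Free) auto
    then show ?thesis
      by (simp add: G_def verts_def)
  qed
  have pos_block: "pos \<sigma> (Suc (a * t + i)) = (Suc a, Suc (\<pi> \<sigma> a i)) \<and> Suc (a * t + i) \<in> {1..n}"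
    if "a < L" "i < t" for \<sigma> a i
  proof -
    have "a * t + i < Suc a * t"
      using that(2) by simp
    also have "\<dots> \<le> L * t"
      using that(1) by (intro mult_le_mono1) simp
    finally have "a * t + i < L * t" .
    then show ?thesis
      using that Lt by (auto simp: pos_def)
  qed
  text \<open>Between consecutive letters the adjacency is that of the relation except along the matching,
    so the graph determines all the matchings.\<close>
  have match: "\<pi> \<sigma> a i = \<pi> \<sigma> (Suc a) j \<longleftrightarrow> \<pi> \<tau> a i = \<pi> \<tau> (Suc a) j"
    if "\<sigma> \<in> S" "\<tau> \<in> S" "G \<sigma> = G \<tau>" "Suc a < L" "i < t" "j < t" for \<sigma> \<tau> a i j
  proof -
    let ?u = "Suc (a * t + i)" and ?v = "Suc (Suc a * t + j)"
    have edge: "(?u, ?v) \<in> edges (G \<rho>) \<longleftrightarrow> ((Suc a, Suc (Suc a)) \<in> E) \<noteq> (\<pi> \<rho> a i = \<pi> \<rho> (Suc a) j)"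
      if \<rho>: "\<rho> \<in> S" for \<rho>
    proof -
      have "\<pi> \<rho> a i < t" "\<pi> \<rho> (Suc a) j < t"
        using perm_lt[OF \<rho>] \<open>Suc a < L\<close> \<open>i < t\<close> \<open>j < t\<close> by auto
      moreover have "(?u, ?v) \<in> edges (G \<rho>) \<longleftrightarrow> (pos \<rho> ?u, pos \<rho> ?v) \<in> edges (strip L E n)"
        using pos_block[of a i] pos_block[of "Suc a" j] \<open>Suc a < L\<close> \<open>i < t\<close> \<open>j < t\<close>
        by (auto simp: G_def edges_def)
      ultimately show ?thesis
        using pos_block[of a i \<rho>] pos_block[of "Suc a" j \<rho>] \<open>Suc a < L\<close> \<open>i < t\<close> \<open>j < t\<close> tn
        by (auto simp: edges_strip consecutive_def)
    qed
    show ?thesis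
      using edge[OF that(1)] edge[OF that(2)] unfolding that(3) by argo
  qed
  have "inj_on G S"
  proof (rule inj_onI)
    fix \<sigma> \<tau> assume st: "\<sigma> \<in> S" "\<tau> \<in> S" "G \<sigma> = G \<tau>"
    \<comment> \<open>Starting from the identity, the permutation of one block and its matching with
      the next determine the permutation of the next.\<close>
    have eq: "\<pi> \<sigma> a i = \<pi> \<tau> a i" if "a < L" "i < t" for a i
      using that
    proof (induction a arbitrary: i)
      case 0
      then show ?case by (simp add: \<pi>_def)
    next
      case (Suc a)
      have "\<pi> \<sigma> (Suc a) i \<in> \<pi> \<sigma> a ` {..<t}"
        using permutes_image[OF perm[OF st(1), of a]] perm_lt[OF st(1) Suc.prems] Suc.prems by simp
      then obtain i' where "i' < t" "\<pi> \<sigma> a i' = \<pi> \<sigma> (Suc a) i"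
        by auto
      moreover have "\<pi> \<tau> a i' = \<pi> \<tau> (Suc a) i"
        using match[OF st, of a i' i] calculation Suc.prems by simp
      ultimately show ?case
        using Suc.IH[of i'] Suc.prems by simp
    qed
    show "\<sigma> = \<tau>"
    proof (rule PiE_ext[OF st(1)[unfolded S_def] st(2)[unfolded S_def]])
      fix a assume a: "a \<in> {1..<L}"
      show "\<sigma> a = \<tau> a"
      proof
        fix i
        have p: "\<sigma> a permutes {..<t}" "\<tau> a permutes {..<t}"
          using perm[OF st(1), of a] perm[OF st(2), of a] a by (auto simp: \<pi>_def)
        show "\<sigma> a i = \<tau> a i"
          using eq[of a i] a p[THEN permutes_not_in, of i] by (cases "i < t") (auto simp: \<pi>_def)
      qed
    qed
  qed
  then have "card S \<le> card {G \<in> Free Fs. verts G = {1..n}}"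
    using G_in finite_speed_set by (intro card_inj_on_le) auto
  moreover have "card S = fact t ^ (L - 1)"
    by (simp add: S_def P_def card_PiE card_permutations)
  ultimately show ?thesis
    by (simp add: speed_def t_def)
qed

text \<open>The single term \<open>n ^ n / fact n\<close> of the exponential series is at most
  \<open>exp n\<close>.\<close>

lemma ln_fact_ge:
  assumes "n > 0"
  shows "ln (fact n) \<ge> real n * (ln (real n) - 1)"
proof -
  have "real n ^ n /\<^sub>R fact n \<le> (\<Sum>k. real n ^ k /\<^sub>R fact k)"
    using sum_le_suminf[OF sums_summable[OF exp_converges[of "real n"]], of "{n}"] by simp
  then have "real n ^ n \<le> exp (real n) * fact n"
    using sums_unique[OF exp_converges[of "real n"]] by (simp add: divide_simps)
  then have "ln (real n ^ n) \<le> ln (exp (real n) * fact n)"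
    using assms by (subst ln_le_cancel_iff) auto
  then show ?thesis
    using assms by (simp add: ln_realpow ln_mult algebra_simps)
qed

text \<open>With more than \<open>1 / \<epsilon>\<close> letters, the logarithm of the product of
  factorials is asymptotic to \<open>(1 - 1 / L) * n * ln n\<close>, which exceeds
  \<open>(1 - \<epsilon>) * n * ln n\<close>.\<close>

lemma above_Bell_of_strips:
  assumes strips: "\<And>l m. l > 0 \<Longrightarrow> m > 0 \<Longrightarrow>
      \<exists>E. loop_graph_on {1..l} E \<and> contains_graph (Free Fs) (strip l E m)"
  shows "above_Bell (Free Fs)"
  unfolding above_Bell_iff
proof (intro allI impI)
  fix \<epsilon> :: real assume \<epsilon>: "\<epsilon> > 0"
  obtain L :: nat where L: "L > 0" "1 / real L < \<epsilon>"
    using nat_approx_posE[OF \<epsilon>] by (metis zero_less_Suc)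
  define c where "c = real L"
  have c: "c > 0" "1 / c < \<epsilon>" "c \<ge> 1"
    using L by (auto simp: c_def)
  have "((\<lambda>x::real. (c - 1) * ((x / c - 1) * (ln (x / c - 1) - 1)) / (x * ln x)) \<longlongrightarrow> (c - 1) * inverse c) at_top"
    using c(1) by real_asymp
  moreover have "(c - 1) * inverse c > 1 - \<epsilon>"
    using c by (simp add: field_simps)
  ultimately have "\<forall>\<^sub>F x in at_top. (c - 1) * ((x / c - 1) * (ln (x / c - 1) - 1)) / (x * ln x) > 1 - \<epsilon>"
    by (rule order_tendstoD(1))
  moreover have "\<forall>\<^sub>F x::real in at_top. x / c - 1 > 1 \<and> ln (x / c - 1) \<ge> 1"
    using c(1) by (intro eventually_conj; real_asymp)
  ultimately have "\<forall>\<^sub>F x in at_top. (c - 1) * ((x / c - 1) * (ln (x / c - 1) - 1)) / (x * ln x) > 1 - \<epsilon>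
      \<and> x / c - 1 > 1 \<and> ln (x / c - 1) \<ge> 1"
    by (rule eventually_conj)
  from eventually_compose_filterlim[OF this filterlim_real_sequentially]
  show "\<forall>\<^sub>F n in sequentially. real n powr ((1 - \<epsilon>) * real n) \<le> real (speed (Free Fs) n)"
    using eventually_ge_at_top[of "2::nat"]
  proof eventually_elim
    case (elim n)
    \<comment> \<open>\<open>s\<close> is a real lower bound for the integer quotient
      \<open>t\<close>, suited to asymptotics; \<open>ln s \<ge> 1\<close> makes both factors below
      nonnegative, so that their product is monotone.\<close>
    define s where "s = real n / c - 1"
    define t where "t = n div L"
    have s: "s > 1" "ln s \<ge> 1"
      using elim by (auto simp: s_def)
    have st: "s \<le> real t"
    proof -
      have "n < (t + 1) * L"
        unfolding t_def using dividend_less_div_times[OF L(1), of n] by (simp add: algebra_simps)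
      then have "real n < (real t + 1) * c"
        unfolding c_def by (metis of_nat_1 of_nat_add of_nat_less_iff of_nat_mult)
      then show ?thesis
        using c(1) by (simp add: s_def diff_le_eq pos_divide_le_eq)
    qed
    have n: "real n * ln (real n) > 0"
      using elim by simp
    obtain E where E: "loop_graph_on {1..L} E" "contains_graph (Free Fs) (strip L E n)"
      using strips[OF L(1), of n] elim by auto
    have le: "fact t ^ (L - 1) \<le> speed (Free Fs) n"
      unfolding t_def using fact_power_le_speed[OF E L(1)] elim by simp
    have "(1 - \<epsilon>) * (real n * ln (real n)) \<le> (c - 1) * (s * (ln s - 1))"
      using elim n by (simp add: s_def pos_less_divide_eq less_imp_le)
    also have "s * (ln s - 1) \<le> real t * (ln (real t) - 1)"
      using s st by (intro mult_mono) auto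
    also have "real t * (ln (real t) - 1) \<le> ln (fact t)"
      using s st by (intro ln_fact_ge) auto
    also have "(c - 1) * ln (fact t) = ln (fact t ^ (L - 1))"
      using L(1) by (simp add: c_def ln_realpow)
    also have "\<dots> \<le> ln (real (speed (Free Fs) n))"
    proof (subst ln_le_cancel_iff)
      show "fact t ^ (L - 1) \<le> real (speed (Free Fs) n)"
        using le by (metis of_nat_fact of_nat_le_iff of_nat_power)
      then show "real (speed (Free Fs) n) > 0"
        by (meson fact_gt_zero less_le_trans zero_less_power)
    qed simp
    finally have "exp ((1 - \<epsilon>) * (real n * ln (real n))) \<le> exp (ln (real (speed (Free Fs) n)))"
      using c(3) by (simp add: mult_left_mono)
    moreover have "real (speed (Free Fs) n) > 0"
      using le by (metis fact_gt_zero less_le_trans of_nat_0_less_iff zero_less_power)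
    ultimately show ?case
      using elim by (simp add: powr_def mult.assoc)
  qed
qed

section \<open>Bounded distinguishing number: a colouring with few exceptions\<close>

definition nbhd_class :: "'v graph \<Rightarrow> 'v set \<Rightarrow> 'v set \<Rightarrow> 'v set" where
  "nbhd_class G S T = {x \<in> verts G. nbhd_in G S x = T}"

lemma nbhd_class_subset: "nbhd_class G S T \<subseteq> verts G"
  by (auto simp: nbhd_class_def)

text \<open>Enlarging \<open>S\<close> by one vertex refines the partition into classes. This
  describes how a splitting set grows.\<close>

lemma nbhd_class_insert:
  assumes "v \<notin> S" "T \<subseteq> S"
  shows "nbhd_class G (insert v S) T = {u \<in> nbhd_class G S T. (u, v) \<notin> edges G}"
    and "nbhd_class G (insert v S) (insert v T) = {u \<in> nbhd_class G S T. (u, v) \<in> edges G}"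
proof -
  have v: "v \<notin> T" "v \<notin> nbhd_in G S u" for u
    using assms by (auto simp: nbhd_in_def)
  have nb: "nbhd_in G (insert v S) u = (if (u, v) \<in> edges G then insert v (nbhd_in G S u) else nbhd_in G S u)" for u
    by (auto simp: nbhd_in_def)
  have "nbhd_in G (insert v S) u = T \<longleftrightarrow> (u, v) \<notin> edges G \<and> nbhd_in G S u = T"
    "nbhd_in G (insert v S) u = insert v T \<longleftrightarrow> (u, v) \<in> edges G \<and> nbhd_in G S u = T" for u
    unfolding nb using v insert_ident[of v "nbhd_in G S u" T] by auto
  then show "nbhd_class G (insert v S) T = {u \<in> nbhd_class G S T. (u, v) \<notin> edges G}"
    "nbhd_class G (insert v S) (insert v T) = {u \<in> nbhd_class G S T. (u, v) \<in> edges G}"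
    by (auto simp: nbhd_class_def)
qed

lemma distinguishes_nbhd_classes:
  assumes "S \<subseteq> verts G" "bij_betw h {0..<M} \<T>"
  shows "distinguishes G S (\<lambda>i. nbhd_class G S (h i)) M"
proof -
  have "h i \<noteq> h j" if "i < M" "j < M" "i \<noteq> j" for i j
    using inj_onD[OF bij_betw_imp_inj_on[OF assms(2)], of i j] that by auto
  then show ?thesis
    unfolding distinguishes_def nbhd_class_def using assms(1) by auto
qed

text \<open>A set \<open>S\<close> of at most \<open>r\<close> vertices splitting off \<open>r\<close> classes of size at least
  \<open>2 ^ (M - r) * k\<close>, with \<open>r\<close> maximal. The threshold is halved with \<open>r\<close> so that every old class
  keeps a large half when one further vertex splits some class into two large parts.\<close>

lemma maximal_splitting:
  assumes fin: "finite (verts G)" and k: "k > 0"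
    and no_split: "\<forall>S U. distinguishes G S U M \<longrightarrow> (\<exists>i<M. card (U i) < k)"
  shows "\<exists>S \<T> K. S \<subseteq> verts G \<and> card S \<le> M \<and> \<T> \<subseteq> Pow S \<and> card \<T> \<le> M \<and> 0 < K \<and> K \<le> 2 ^ M * k \<and>
    (\<forall>T. T \<notin> \<T> \<longrightarrow> card (nbhd_class G S T) < K) \<and>
    (\<forall>v\<in>verts G. \<forall>T\<in>\<T>. card {u \<in> nbhd_class G S T. (u, v) \<in> edges G} < K \<or>
       card {u \<in> nbhd_class G S T. (u, v) \<notin> edges G} < K)"
proof -
  define K where "K r = 2 ^ (M - r) * k" for r
  define Q where "Q r \<longleftrightarrow> (\<exists>S \<T>. S \<subseteq> verts G \<and> card S \<le> r \<and> \<T> \<subseteq> Pow S \<and> card \<T> = r \<and>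
    (\<forall>T\<in>\<T>. K r \<le> card (nbhd_class G S T)))" for r
  have "Q 0"
    unfolding Q_def by (intro exI[of _ "{}"]) simp
  moreover have "\<not> Q M"
  proof
    assume "Q M"
    then obtain S \<T> where S: "S \<subseteq> verts G" "\<T> \<subseteq> Pow S" "card \<T> = M"
      "\<forall>T\<in>\<T>. K M \<le> card (nbhd_class G S T)"
      unfolding Q_def by blast
    have "finite \<T>"
      using S(1,2) fin by (meson finite_Pow_iff finite_subset)
    then obtain h where h: "bij_betw h {0..<M} \<T>"
      using ex_bij_betw_nat_finite[of \<T>] S(3) by blast
    obtain i where "i < M" "card (nbhd_class G S (h i)) < k"
      using no_split[rule_format, OF distinguishes_nbhd_classes[OF S(1) h]] by blast
    moreover have "h i \<in> \<T>"
      using bij_betw_apply[OF h, of i] calculation by simp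
    ultimately show False
      using S(4) by (fastforce simp: K_def)
  qed
  ultimately obtain r where r: "r < M" "Q r" "\<not> Q (Suc r)"
    using ex_least_nat_less[of "\<lambda>n. \<not> Q n" M] by auto
  then obtain S \<T> where S: "S \<subseteq> verts G" "card S \<le> r" "\<T> \<subseteq> Pow S" "card \<T> = r"
    "\<forall>T\<in>\<T>. K r \<le> card (nbhd_class G S T)"
    unfolding Q_def by blast
  have finS: "finite S" and finT: "finite \<T>"
    using S(1,3) fin finite_subset by (blast, meson finite_Pow_iff finite_subset)
  have K2: "K r = 2 * K (Suc r)"
    using r(1) by (simp add: K_def Suc_diff_Suc flip: power_Suc)
  have K_pos: "K (Suc r) > 0"
    using k by (simp add: K_def)
  have finC: "finite (nbhd_class G S T)" for T
    using finite_subset[OF nbhd_class_subset fin] .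
  have other: "card (nbhd_class G S T) < K (Suc r)" if "T \<notin> \<T>" for T
  proof (cases "T \<subseteq> S")
    case True
    show ?thesis
    proof (rule ccontr)
      assume "\<not> ?thesis"
      then have "\<forall>T\<in>insert T \<T>. K (Suc r) \<le> card (nbhd_class G S T)"
        using S(5) K2 by force
      moreover have "card (insert T \<T>) = Suc r" "insert T \<T> \<subseteq> Pow S" "card S \<le> Suc r"
        using that True S finT by auto
      ultimately have "Q (Suc r)"
        unfolding Q_def using S(1) by blast
      with r(3) show False ..
    qed
  next
    case False
    then have "nbhd_class G S T = {}"
      by (auto simp: nbhd_class_def nbhd_in_def)
    then show ?thesis
      using K_pos by simp
  qed
  have split: "card {u \<in> nbhd_class G S T. (u, v) \<in> edges G} < K (Suc r) \<or>
       card {u \<in> nbhd_class G S T. (u, v) \<notin> edges G} < K (Suc r)"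
    if v: "v \<in> verts G" and T: "T \<in> \<T>" for v T
  proof (cases "v \<in> S")
    case True
    then have "{u \<in> nbhd_class G S T. (u, v) \<in> edges G} = {} \<or> {u \<in> nbhd_class G S T. (u, v) \<notin> edges G} = {}"
      by (auto simp: nbhd_class_def nbhd_in_def)
    then show ?thesis
      using K_pos by (elim disjE) (simp_all only: card.empty simp_thms)
  next
    case False
    \<comment> \<open>\<open>g\<close> continues every old class by a half that is still large: the
      neighbours of \<open>v\<close> if there are enough of them, otherwise the
      non-neighbours.\<close>
    define g where "g T' = (if K (Suc r) \<le> card {u \<in> nbhd_class G S T'. (u, v) \<in> edges G}
      then insert v T' else T')" for T'
    have g_S: "g T' \<inter> S = T'" if "T' \<in> \<T>" for T'
      using that S(3) False by (auto simp: g_def)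
    show ?thesis
    proof (rule ccontr)
      assume "\<not> ?thesis"
      then have big: "K (Suc r) \<le> card {u \<in> nbhd_class G S T. (u, v) \<in> edges G}"
        "K (Suc r) \<le> card {u \<in> nbhd_class G S T. (u, v) \<notin> edges G}"
        by auto
      \<comment> \<open>Both halves of \<open>T\<close> are large: \<open>g T\<close> accounts for
        the neighbours and \<open>T\<close> itself for the non-neighbours, which adds one
        class.\<close>
      let ?\<T> = "insert T (g ` \<T>)"
      have "g T = insert v T"
        using big by (simp add: g_def)
      moreover have "T \<subseteq> S"
        using T S(3) by blast
      ultimately have "g T \<noteq> T"
        using False by blast
      then have "T \<notin> g ` \<T>"
        using g_S T \<open>T \<subseteq> S\<close> by (metis imageE inf.absorb1)
      moreover have "inj_on g \<T>"
        using g_S by (metis inj_onI)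
      ultimately have "card ?\<T> = Suc r"
        using finT S(4) by (simp add: card_image)
      moreover have "?\<T> \<subseteq> Pow (insert v S)"
        using S(3) T by (auto simp: g_def)
      moreover have "card (insert v S) \<le> Suc r"
        using S(2) False finS by simp
      moreover have "insert v S \<subseteq> verts G"
        using S(1) v by simp
      moreover have "K (Suc r) \<le> card (nbhd_class G (insert v S) T')" if "T' \<in> ?\<T>" for T'
      proof (cases "T' = T")
        case True
        then show ?thesis
          using big(2) nbhd_class_insert(1)[OF False \<open>T \<subseteq> S\<close>] by simp
      next
        case 2: False
        then obtain T0 where T0: "T0 \<in> \<T>" "T' = g T0"
          using \<open>T' \<in> ?\<T>\<close> by blast
        then have "T0 \<subseteq> S"
          using S(3) by blast
        note cl = nbhd_class_insert[OF False this, of G]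
        let ?A = "{u \<in> nbhd_class G S T0. (u, v) \<in> edges G}"
          and ?B = "{u \<in> nbhd_class G S T0. (u, v) \<notin> edges G}"
        have "card (nbhd_class G S T0) = card ?A + card ?B"
          using finC by (subst card_Un_disjoint[symmetric]) (auto intro: arg_cong[where f = card])
        moreover have "2 * K (Suc r) \<le> card (nbhd_class G S T0)"
          using S(5) T0(1) K2 by simp
        ultimately show ?thesis
          unfolding T0(2) g_def using cl by (cases "K (Suc r) \<le> card ?A") auto
      qed
      ultimately have "insert v S \<subseteq> verts G \<and> card (insert v S) \<le> Suc r \<and> ?\<T> \<subseteq> Pow (insert v S) \<and>
          card ?\<T> = Suc r \<and> (\<forall>T'\<in>?\<T>. K (Suc r) \<le> card (nbhd_class G (insert v S) T'))"
        by (intro conjI ballI)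
      then have "Q (Suc r)"
        unfolding Q_def by (intro exI)
      with r(3) show False ..
    qed
  qed
  have "K (Suc r) \<le> 2 ^ M * k"
    by (simp add: K_def power_increasing)
  with S r(1) K_pos other split show ?thesis
    by (intro exI[of _ S] exI[of _ \<T>] exI[of _ "K (Suc r)"]) auto
qed

text \<open>Outside \<open>W\<close>, this is the symmetric difference of \<open>G\<close> and the
  graph blown up from \<open>E\<close> along the colouring \<open>c\<close>. On an induced path of
  flips, \<open>G\<close> is the word graph of the colours.\<close>

definition flips :: "'v graph \<Rightarrow> 'v set \<Rightarrow> ('v \<Rightarrow> nat) \<Rightarrow> (nat \<times> nat) set \<Rightarrow> ('v \<times> 'v) set" where
  "flips G W c E = {(u, v). u \<in> verts G - W \<and> v \<in> verts G - W \<and> u \<noteq> v \<and>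
     ((u, v) \<in> edges G) \<noteq> ((c u, c v) \<in> E)}"

text \<open>Counting failing pairs from \<open>B\<close> and holding pairs from \<open>A\<close>
  gives \<open>card A * card B \<le> (card A + card B) * K\<close>, which is impossible when both
  sets are larger than \<open>2 * K\<close>.\<close>

lemma sparse_dense_small:
  fixes A :: "'a set" and B :: "'b set"
  assumes "finite A" "finite B"
    and "\<And>y. y \<in> B \<Longrightarrow> card {x \<in> A. \<not> R x y} \<le> K"
    and "\<And>x. x \<in> A \<Longrightarrow> card {y \<in> B. R x y} \<le> K"
  shows "card A \<le> 2 * K \<or> card B \<le> 2 * K"
proof (rule ccontr)
  assume "\<not> ?thesis"
  then have big: "2 * K < card A" "2 * K < card B"
    by auto
  have split: "card A = card {x \<in> A. \<not> R x y} + card {x \<in> A. R x y}" for y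
    using assms(1) by (subst card_Un_disjoint[symmetric]) (auto intro: arg_cong[where f = card])
  have "card A * card B = (\<Sum>y\<in>B. card {x \<in> A. \<not> R x y} + card {x \<in> A. R x y})"
    using split by simp
  also have "\<dots> = (\<Sum>y\<in>B. card {x \<in> A. \<not> R x y}) + (\<Sum>y\<in>B. card {x \<in> A. R x y})"
    by (rule sum.distrib)
  also have "(\<Sum>y\<in>B. card {x \<in> A. R x y}) = (\<Sum>x\<in>A. card {y \<in> B. R x y})"
    using assms(1,2) by (simp add: card_eq_sum sum.inter_filter sum.swap[of _ B A] del: sum_constant)
  also have "\<dots> \<le> card A * K"
    using sum_bounded_above[of A "\<lambda>x. card {y \<in> B. R x y}" K] assms(4) by simp
  also have "(\<Sum>y\<in>B. card {x \<in> A. \<not> R x y}) \<le> card B * K"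
    using sum_bounded_above[of B "\<lambda>y. card {x \<in> A. \<not> R x y}" K] assms(3) by simp
  finally have "card A * card B \<le> card B * K + card A * K"
    by simp
  moreover have "2 * K * card B < card A * card B" "card A * (2 * K) < card A * card B"
    using big by (auto intro!: mult_strict_right_mono mult_strict_left_mono)
  ultimately show False
    by (simp only: mult.commute mult.left_commute)
qed

text \<open>A vertex is coloured by its neighbourhood in \<open>S\<close> and by the large classes
  in which it has many neighbours. Vertices of rare colours are exceptional. Elsewhere the colours
  predict adjacency, and each vertex sees fewer than \<open>K\<close> errors in each of at most
  \<open>M\<close> classes.\<close>

lemma flip_structure:
  assumes simple: "simple_graph G" and k: "k > 0"
    and no_split: "\<forall>S U. distinguishes G S U M \<longrightarrow> (\<exists>i<M. card (U i) < k)"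
  shows "\<exists>W c E. W \<subseteq> verts G \<and> card W \<le> 4 ^ M * (2 * (2 ^ M * k)) \<and> c ` verts G \<subseteq> {..<4 ^ M} \<and>
    loop_graph_on {..<4 ^ M} E \<and> (\<forall>v. card (flips G W c E `` {v}) \<le> M * (2 ^ M * k))"
proof -
  have fin: "finite (verts G)" and adj_sym: "\<And>u v. (u, v) \<in> edges G \<longleftrightarrow> (v, u) \<in> edges G"
    using simple by (auto simp: simple_graph_def sym_def)
  obtain S \<T> K where S: "S \<subseteq> verts G" "card S \<le> M" "\<T> \<subseteq> Pow S" "card \<T> \<le> M"
    and K: "0 < K" "K \<le> 2 ^ M * k"
    and other: "\<forall>T. T \<notin> \<T> \<longrightarrow> card (nbhd_class G S T) < K"
    and split: "\<forall>v\<in>verts G. \<forall>T\<in>\<T>. card {u \<in> nbhd_class G S T. (u, v) \<in> edges G} < K \<or>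
       card {u \<in> nbhd_class G S T. (u, v) \<notin> edges G} < K"
    using maximal_splitting[OF fin k no_split] by (elim exE conjE) (rule that)
  have finS: "finite S" and finT: "finite \<T>"
    using S(1,3) fin finite_subset by (blast, meson finite_Pow_iff finite_subset)
  have finC: "finite (nbhd_class G S T)" for T
    using finite_subset[OF nbhd_class_subset fin] .
  define N where "N v = nbhd_in G S v" for v
  define dense where "dense v = {T \<in> \<T>. K \<le> card {u \<in> nbhd_class G S T. (u, v) \<in> edges G}}" for v
  define col where "col v = (N v, dense v)" for v
  have "col ` verts G \<subseteq> Pow S \<times> Pow \<T>"
    by (auto simp: col_def N_def dense_def nbhd_in_def)
  then have "card (col ` verts G) \<le> card (Pow S \<times> Pow \<T>)"
    using finS finT by (intro card_mono) auto
  also have "\<dots> \<le> 2 ^ M * 2 ^ M"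
    using S finS finT unfolding card_cartesian_product
    by (intro mult_le_mono) (simp_all add: card_Pow)
  also have "\<dots> = (4::nat) ^ M"
    by (simp flip: power_mult_distrib)
  finally have card_col: "card (col ` verts G) \<le> 4 ^ M" .
  then obtain h where h: "inj_on h (col ` verts G)" "h ` col ` verts G \<subseteq> {..<4 ^ M :: nat}"
    using card_le_inj[of "col ` verts G" "{..<4 ^ M :: nat}"] fin by auto
  define V where "V \<alpha> = {v \<in> verts G. col v = \<alpha>}" for \<alpha>
  \<comment> \<open>The threshold \<open>2 * K\<close> is the one under which double counting forces
    the prediction to be symmetric.\<close>
  define W where "W = {v \<in> verts G. card (V (col v)) \<le> 2 * K}"
  have finV: "finite (V \<alpha>)" for \<alpha>
    using fin by (simp add: V_def)
  have "W = (\<Union>\<alpha>\<in>col ` W. V \<alpha>)"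
    by (auto simp: W_def V_def)
  then have "card W \<le> (\<Sum>\<alpha>\<in>col ` W. card (V \<alpha>))"
    using card_UN_le[of "col ` W" V] fin by (simp add: W_def)
  also have "\<dots> \<le> (\<Sum>\<alpha>\<in>col ` W. 2 * K)"
    by (rule sum_mono) (auto simp: W_def)
  also have "\<dots> = card (col ` W) * (2 * K)"
    by simp
  also have "\<dots> \<le> 4 ^ M * (2 * (2 ^ M * k))"
  proof (intro mult_le_mono)
    have "card (col ` W) \<le> card (col ` verts G)"
      using fin by (intro card_mono) (auto simp: W_def)
    with card_col show "card (col ` W) \<le> 4 ^ M"
      by linarith
  qed (use K in auto)
  finally have card_W: "card W \<le> 4 ^ M * (2 * (2 ^ M * k))" .
  have V_class: "V (col v) \<subseteq> nbhd_class G S (N v)" for v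
    by (auto simp: V_def col_def nbhd_class_def N_def)
  have N_in: "N v \<in> \<T>" if "v \<in> verts G - W" for v
  proof (rule ccontr)
    assume "N v \<notin> \<T>"
    then have "card (nbhd_class G S (N v)) < K"
      using other by blast
    then have "card (V (col v)) < K"
      using card_mono[OF finC V_class] by (rule le_less_trans[rotated])
    then show False
      using that by (simp add: W_def)
  qed
  \<comment> \<open>Maximality of the splitting makes one of the two halves of the class small, and
    \<open>dense v\<close> tells which one.\<close>
  have wrong: "card {x \<in> nbhd_class G S T. ((x, v) \<in> edges G) \<noteq> (T \<in> dense v)} < K"
    if "v \<in> verts G" "T \<in> \<T>" for v T
  proof (cases "T \<in> dense v")
    case True
    then have "\<not> card {u \<in> nbhd_class G S T. (u, v) \<in> edges G} < K"
      by (simp add: dense_def)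
    then show ?thesis
      using split[rule_format, OF that] True by simp
  next
    case False
    then show ?thesis
      using that by (simp add: dense_def)
  qed
  \<comment> \<open>Were the two directions to disagree, the colour classes of \<open>u\<close> and
    \<open>v\<close> would be nearly completely joined seen from one side and nearly unjoined seen
    from the other, although both are large.\<close>
  have half: "N v \<in> dense u" if uv: "u \<in> verts G - W" "v \<in> verts G - W" and "N u \<in> dense v" for u v
  proof (rule ccontr)
    assume "N v \<notin> dense u"
    have "card (V (col u)) \<le> 2 * K \<or> card (V (col v)) \<le> 2 * K"
    proof (rule sparse_dense_small[where R = "\<lambda>x y. (x, y) \<in> edges G"])
      fix y assume y: "y \<in> V (col v)"
      then have "dense y = dense v" "y \<in> verts G"
        by (auto simp: V_def col_def)
      then have "card {x \<in> nbhd_class G S (N u). (x, y) \<notin> edges G} < K"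
        using wrong[of y "N u"] N_in[OF uv(1)] that(3) by simp
      moreover have "card {x \<in> V (col u). (x, y) \<notin> edges G} \<le> card {x \<in> nbhd_class G S (N u). (x, y) \<notin> edges G}"
        using V_class[of u] finC by (intro card_mono) auto
      ultimately show "card {x \<in> V (col u). (x, y) \<notin> edges G} \<le> K"
        by simp
    next
      fix x assume x: "x \<in> V (col u)"
      then have "dense x = dense u" "x \<in> verts G"
        by (auto simp: V_def col_def)
      then have "card {y \<in> nbhd_class G S (N v). (y, x) \<in> edges G} < K"
        using wrong[of x "N v"] N_in[OF uv(2)] \<open>N v \<notin> dense u\<close> by simp
      moreover have "card {y \<in> V (col v). (x, y) \<in> edges G} \<le> card {y \<in> nbhd_class G S (N v). (y, x) \<in> edges G}"
        using V_class[of v] finC adj_sym by (intro card_mono) auto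
      ultimately show "card {y \<in> V (col v). (x, y) \<in> edges G} \<le> K"
        by simp
    qed (rule finV)+
    then show False
      using uv by (auto simp: W_def)
  qed
  define c where "c v = h (col v)" for v
  define E where "E = {(c u, c v) | u v. u \<in> verts G - W \<and> v \<in> verts G - W \<and> N u \<in> dense v}"
  have E_iff: "(c u, c v) \<in> E \<longleftrightarrow> N u \<in> dense v" if "u \<in> verts G - W" "v \<in> verts G - W" for u v
  proof
    assume "(c u, c v) \<in> E"
    then obtain u' v' where *: "c u = c u'" "c v = c v'" "u' \<in> verts G" "v' \<in> verts G" "N u' \<in> dense v'"
      unfolding E_def by blast
    have "col u = col u'" "col v = col v'"
      using * that h(1) by (auto simp: c_def inj_on_eq_iff)
    with *(5) show "N u \<in> dense v"
      by (simp add: col_def)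
  qed (use that in \<open>auto simp: E_def\<close>)
  have c_range: "c ` verts G \<subseteq> {..<4 ^ M}"
    using h(2) by (auto simp: c_def)
  have "loop_graph_on {..<4 ^ M} E"
    using c_range half unfolding loop_graph_on_def sym_def E_def by blast
  moreover have "card (flips G W c E `` {v}) \<le> M * (2 ^ M * k)" for v
  proof (cases "v \<in> verts G - W")
    case True
    have "flips G W c E `` {v} \<subseteq> (\<Union>T\<in>\<T>. {x \<in> nbhd_class G S T. ((x, v) \<in> edges G) \<noteq> (T \<in> dense v)})"
    proof
      fix u assume "u \<in> flips G W c E `` {v}"
      then have u: "u \<in> verts G - W" "((u, v) \<in> edges G) \<noteq> ((c v, c u) \<in> E)"
        using adj_sym by (auto simp: flips_def)
      then have "((u, v) \<in> edges G) \<noteq> (N u \<in> dense v)"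
        using E_iff[OF True u(1)] half True by blast
      moreover have "u \<in> nbhd_class G S (N u)"
        using u(1) by (simp add: nbhd_class_def N_def)
      ultimately show "u \<in> (\<Union>T\<in>\<T>. {x \<in> nbhd_class G S T. ((x, v) \<in> edges G) \<noteq> (T \<in> dense v)})"
        using N_in[OF u(1)] by blast
    qed
    then have "card (flips G W c E `` {v}) \<le>
        card (\<Union>T\<in>\<T>. {x \<in> nbhd_class G S T. ((x, v) \<in> edges G) \<noteq> (T \<in> dense v)})"
      using finT finC by (intro card_mono) auto
    also have "\<dots> \<le> (\<Sum>T\<in>\<T>. card {x \<in> nbhd_class G S T. ((x, v) \<in> edges G) \<noteq> (T \<in> dense v)})"
      using finT by (rule card_UN_le)
    also have "\<dots> \<le> card \<T> * K"
      using sum_bounded_above[of \<T> "\<lambda>T. card {x \<in> nbhd_class G S T. ((x, v) \<in> edges G) \<noteq> (T \<in> dense v)}" K]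
        wrong True by (simp add: less_imp_le)
    also have "\<dots> \<le> M * (2 ^ M * k)"
      using S(4) K(2) by (rule mult_le_mono)
    finally show ?thesis .
  next
    case False
    then have "flips G W c E `` {v} = {}"
      by (auto simp: flips_def)
    then show ?thesis
      by simp
  qed
  moreover have "W \<subseteq> verts G"
    by (auto simp: W_def)
  ultimately show ?thesis
    using card_W c_range by (intro exI[of _ W] exI[of _ c] exI[of _ E]) simp
qed

section \<open>Without long strips the flip graphs have bounded components\<close>

lemma relpow_segment:
  assumes "\<forall>i<n. (f i, f (Suc i)) \<in> D" "a \<le> b" "b \<le> n"
  shows "(f a, f b) \<in> D ^^ (b - a)"
  unfolding relpow_fun_conv using assms by (intro exI[of _ "\<lambda>t. f (a + t)"]) auto

lemma card_relpow_Image: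
  fixes D :: "('a \<times> 'a) set"
  assumes fin: "\<And>v. finite (D `` {v})" and deg: "\<And>v. card (D `` {v}) \<le> d"
  shows "finite {u. \<exists>i\<le>n. (v, u) \<in> D ^^ i} \<and> card {u. \<exists>i\<le>n. (v, u) \<in> D ^^ i} \<le> Suc d ^ n"
proof (induction n)
  case 0
  have "{u. \<exists>i\<le>0. (v, u) \<in> D ^^ i} = {v}"
    by auto
  then show ?case
    by simp
next
  case (Suc n)
  let ?B = "\<lambda>n. {u. \<exists>i\<le>n. (v, u) \<in> D ^^ i}"
  have sub: "?B (Suc n) \<subseteq> (\<Union>u\<in>?B n. insert u (D `` {u}))"
  proof
    fix u assume "u \<in> ?B (Suc n)"
    then obtain i where i: "i \<le> Suc n" "(v, u) \<in> D ^^ i"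
      by blast
    show "u \<in> (\<Union>u\<in>?B n. insert u (D `` {u}))"
    proof (cases "i \<le> n")
      case True
      with i(2) show ?thesis
        by blast
    next
      case False
      then have "i = Suc n"
        using i(1) by simp
      with i(2) obtain x where "(v, x) \<in> D ^^ n" "(x, u) \<in> D"
        by auto
      then show ?thesis
        by blast
    qed
  qed
  have fin_U: "finite (\<Union>u\<in>?B n. insert u (D `` {u}))"
    using Suc fin by blast
  have "card (?B (Suc n)) \<le> card (\<Union>u\<in>?B n. insert u (D `` {u}))"
    by (rule card_mono[OF fin_U sub])
  also have "\<dots> \<le> (\<Sum>u\<in>?B n. card (insert u (D `` {u})))"
    using Suc by (intro card_UN_le) blast
  also have "\<dots> \<le> (\<Sum>u\<in>?B n. Suc d)"
    using deg by (intro sum_mono card_insert_le_m1) simp_all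
  also have "\<dots> = Suc d * card (?B n)"
    by simp
  also have "\<dots> \<le> Suc d * Suc d ^ n"
    by (rule mult_le_mono2[OF conjunct2[OF Suc]])
  finally show ?case
    using finite_subset[OF sub fin_U] by simp
qed

text \<open>A shortest walk to a vertex at distance greater than \<open>R\<close> is an induced path.\<close>

lemma large_component_induced_path:
  fixes D :: "('a \<times> 'a) set"
  assumes "sym D" "irrefl D" "\<And>v. finite (D `` {v})" "\<And>v. card (D `` {v}) \<le> d"
    and large: "Suc d ^ R < card (D\<^sup>* `` {v}) \<or> infinite (D\<^sup>* `` {v})"
  shows "\<exists>f. inj_on f {..R} \<and> (\<forall>i\<le>R. \<forall>j\<le>R. (f i, f j) \<in> D \<longleftrightarrow> consecutive i j)"
proof -
  have "\<not> D\<^sup>* `` {v} \<subseteq> {u. \<exists>i\<le>R. (v, u) \<in> D ^^ i}"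
    using large card_relpow_Image[OF assms(3,4), where v = v and n = R] card_mono finite_subset
    by (metis (no_types, lifting) le_trans not_le)
  then obtain u where u: "(v, u) \<in> D\<^sup>*" "\<And>i. i \<le> R \<Longrightarrow> (v, u) \<notin> D ^^ i"
    by blast
  define m where "m = (LEAST m. (v, u) \<in> D ^^ m)"
  have m: "(v, u) \<in> D ^^ m" and least: "\<And>i. (v, u) \<in> D ^^ i \<Longrightarrow> m \<le> i"
    unfolding m_def using LeastI_ex[OF rtrancl_imp_relpow[OF u(1)]] Least_le by (fast, fast)
  have "R < m"
    using u(2)[of m] m by force
  obtain f where f: "f 0 = v" "f m = u" "\<forall>i<m. (f i, f (Suc i)) \<in> D"
    using m unfolding relpow_fun_conv by blast
  have step: "(f i, f (Suc i)) \<in> D" "(f (Suc i), f i) \<in> D" if "i < m" for i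
    using f(3) that assms(1) by (auto dest: symD)
  \<comment> \<open>Replacing the part between \<open>f i\<close> and \<open>f j\<close> by
    \<open>n\<close> steps cannot beat the shortest walk. The case \<open>n = 0\<close> gives
    injectivity, the case \<open>n = 1\<close> excludes chords.\<close>
  have shortcut: "m \<le> i + n + (m - j)" if "i \<le> m" "j \<le> m" "(f i, f j) \<in> D ^^ n" for i j n
  proof -
    have "(v, f i) \<in> D ^^ i" "(f j, u) \<in> D ^^ (m - j)"
      using relpow_segment[OF f(3), of 0 i] relpow_segment[OF f(3), of j m] that f by auto
    with that(3) have "(v, u) \<in> D ^^ (i + n + (m - j))"
      unfolding relpow_add by blast
    then show ?thesis
      by (rule least)
  qed
  have inj: "\<not> i < j" if "i \<le> m" "j \<le> m" "f i = f j" for i j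
    using shortcut[of i j 0] that by simp
  have close: "j \<le> Suc i" if "i \<le> m" "j \<le> m" "(f i, f j) \<in> D" for i j
    using shortcut[of i j 1] that by simp
  have "inj_on f {..R}"
    using inj \<open>R < m\<close> by (intro inj_onI) (metis atMost_iff le_trans less_imp_le_nat nat_neq_iff)
  moreover have "(f i, f j) \<in> D \<longleftrightarrow> consecutive i j" if "i \<le> R" "j \<le> R" for i j
  proof
    assume D: "(f i, f j) \<in> D"
    then have "(f j, f i) \<in> D"
      using assms(1) by (blast dest: symD)
    then have "j \<le> Suc i" "i \<le> Suc j"
      using close D that \<open>R < m\<close> by auto
    moreover have "i \<noteq> j"
      using D assms(2) by (auto simp: irrefl_def)
    ultimately show "consecutive i j"
      by (auto simp: consecutive_def)
  next
    assume "consecutive i j"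
    then show "(f i, f j) \<in> D"
      using step that \<open>R < m\<close> by (auto simp: consecutive_def)
  qed
  ultimately show ?thesis
    by blast
qed

text \<open>The word is cut into \<open>N\<close> blocks of length \<open>Suc l\<close>, whose first
  \<open>l\<close> letters take at most \<open>s ^ l\<close> values. Some value occurs in
  \<open>m\<close> blocks, which become the copies; the last position of each block is a gap between
  copies.\<close>

lemma strip_of_long_word:
  assumes x: "x ` {..<N * Suc l} \<subseteq> {..<s}" and E: "loop_graph_on A E" and N: "m * s ^ l < N" "l > 0"
  shows "\<exists>E'. loop_graph_on {1..l} E' \<and> induced_sub (strip l E' m) (GwH x E {..<N * Suc l})"
proof -
  define win where "win b = map (\<lambda>i. x (b * Suc l + i)) [0..<l]" for b
  let ?B = "{y. set y \<subseteq> {..<s} \<and> length y = l}"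
  have in_range: "b * Suc l + i < N * Suc l" if "b < N" "i < l" for b i
  proof -
    have "b * Suc l + i < Suc b * Suc l"
      using that by simp
    also have "\<dots> \<le> N * Suc l"
      using that(1) by (intro mult_le_mono1) simp
    finally show ?thesis .
  qed
  have win: "win \<in> {..<N} \<rightarrow> ?B"
    using x in_range by (fastforce simp: win_def)
  have B: "finite ?B" "card ?B = s ^ l"
    using finite_lists_length_eq[of "{..<s}" l] card_lists_length_eq[of "{..<s}" l] by auto
  have "?B \<noteq> {}"
    using win N(1) by (auto simp: Pi_def)
  from pigeonhole_card[OF win finite_lessThan B(1) this]
  obtain y where y: "y \<in> ?B" "N \<le> card (win -` {y} \<inter> {..<N}) * s ^ l"
    unfolding B(2) card_lessThan by (elim bexE)
  have "m * s ^ l < card (win -` {y} \<inter> {..<N}) * s ^ l"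
    using N(1) y(2) by linarith
  then have "m \<le> card (win -` {y} \<inter> {..<N})"
    by simp
  then obtain T where T: "T \<subseteq> win -` {y} \<inter> {..<N}" "card T = m" "finite T"
    by (rule obtain_subset_with_card_n)
  obtain \<beta> where \<beta>: "bij_betw \<beta> {1..m} T"
    using ex_bij_betw_nat_finite_1[OF T(3)] T(2) by blast
  have \<beta>_in: "\<beta> j < N \<and> win (\<beta> j) = y" if "j \<in> {1..m}" for j
    using bij_betw_apply[OF \<beta> that] T(1) by auto
  define \<phi> where "\<phi> = (\<lambda>(a, j). \<beta> j * Suc l + (a - 1))"
  define E' where "E' = {(a, b). a \<in> {1..l} \<and> b \<in> {1..l} \<and> (y ! (a - 1), y ! (b - 1)) \<in> E}"
  have \<phi>_in: "\<phi> (a, j) < N * Suc l" and x\<phi>: "x (\<phi> (a, j)) = y ! (a - 1)"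
    if "a \<in> {1..l}" "j \<in> {1..m}" for a j
  proof -
    have a: "a - 1 < l"
      using that(1) by auto
    then show "\<phi> (a, j) < N * Suc l"
      using in_range \<beta>_in[OF that(2)] by (simp add: \<phi>_def)
    have "y ! (a - 1) = win (\<beta> j) ! (a - 1)"
      using \<beta>_in[OF that(2)] by simp
    then show "x (\<phi> (a, j)) = y ! (a - 1)"
      using a by (simp add: \<phi>_def win_def)
  qed
  have far: "\<beta> j * Suc l + (a - 1) + 1 < \<beta> k * Suc l + (b - 1)"
    if "a \<in> {1..l}" "\<beta> j < \<beta> k" for a b j k
  proof -
    have "Suc (\<beta> j) * Suc l \<le> \<beta> k * Suc l"
      using that(2) by (intro mult_le_mono1) simp
    then have "\<beta> j * Suc l + Suc l \<le> \<beta> k * Suc l"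
      by simp
    moreover have "a - 1 + 1 < Suc l"
      using that(1) by auto
    ultimately show ?thesis
      by linarith
  qed
  have \<phi>: "(\<phi> (a, j) = \<phi> (b, k) \<longleftrightarrow> (a, j) = (b, k)) \<and>
      (consecutive (\<phi> (a, j)) (\<phi> (b, k)) \<longleftrightarrow> consecutive a b \<and> j = k)"
    if "a \<in> {1..l}" "b \<in> {1..l}" "j \<in> {1..m}" "k \<in> {1..m}" for a b j k
  proof -
    have "\<beta> j = \<beta> k \<longleftrightarrow> j = k"
      using inj_on_eq_iff[OF bij_betw_imp_inj_on[OF \<beta>]] that by blast
    then show ?thesis
      using far[of a j k b] far[of b k j a] that
      by (cases "\<beta> j" "\<beta> k" rule: linorder_cases) (auto simp: \<phi>_def consecutive_def)
  qed
  have "induced_sub (strip l E' m) (GwH x E {..<N * Suc l})"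
    unfolding induced_sub_def verts_strip verts_GwH
  proof (intro exI[of _ \<phi>] conjI ballI)
    show "inj_on \<phi> ({1..l} \<times> {1..m})"
      using \<phi> by (intro inj_onI) auto
    show "\<phi> ` ({1..l} \<times> {1..m}) \<subseteq> {..<N * Suc l}"
      using \<phi>_in by auto
  next
    fix p q assume pq: "p \<in> {1..l} \<times> {1..m}" "q \<in> {1..l} \<times> {1..m}"
    obtain a j b k where eq: "p = (a, j)" "q = (b, k)"
      by fastforce
    with pq have in_range: "a \<in> {1..l}" "b \<in> {1..l}" "j \<in> {1..m}" "k \<in> {1..m}"
      by auto
    show "(p, q) \<in> edges (strip l E' m) \<longleftrightarrow> (\<phi> p, \<phi> q) \<in> edges (GwH x E {..<N * Suc l})"
      unfolding eq edges_strip edges_GwH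
      using \<phi>[OF in_range] \<phi>_in[of a j] \<phi>_in[of b k] x\<phi>[of a j] x\<phi>[of b k] in_range
      by (auto simp: E'_def)
  qed
  moreover have "loop_graph_on {1..l} E'"
    using E by (auto simp: loop_graph_on_def E'_def sym_def)
  ultimately show ?thesis
    by blast
qed

lemma flips_symmetric_finite:
  assumes "simple_graph G" "loop_graph_on A E"
  shows "sym (flips G W c E)" "irrefl (flips G W c E)" "finite (flips G W c E)"
proof -
  have "(u, v) \<in> edges G \<longleftrightarrow> (v, u) \<in> edges G" "(a, b) \<in> E \<longleftrightarrow> (b, a) \<in> E" for u v a b
    using assms by (auto simp: simple_graph_def loop_graph_on_def dest: symD)
  then show "sym (flips G W c E)" "irrefl (flips G W c E)"
    by (auto simp: flips_def sym_def irrefl_def)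
  have "flips G W c E \<subseteq> verts G \<times> verts G"
    by (auto simp: flips_def)
  then show "finite (flips G W c E)"
    using assms(1) by (auto simp: simple_graph_def intro: finite_subset)
qed

text \<open>A large component contains a long induced path of flips, along which \<open>G\<close> is
  the word graph of the colours. Repeated blocks of that word would form the excluded strip.\<close>

lemma bounded_flip_components:
  assumes G: "G \<in> Free Fs" and E: "loop_graph_on {..<s} E" and c: "c ` verts G \<subseteq> {..<s}"
    and deg: "\<forall>v. card (flips G W c E `` {v}) \<le> d"
    and l: "l > 0" "\<And>E. loop_graph_on {1..l} E \<Longrightarrow> \<not> contains_graph (Free Fs) (strip l E m)"
  shows "finite ((flips G W c E)\<^sup>* `` {v}) \<and>
    card ((flips G W c E)\<^sup>* `` {v}) \<le> Suc d ^ (Suc (m * s ^ l) * Suc l)"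
proof (rule ccontr)
  let ?D = "flips G W c E" and ?R = "Suc (m * s ^ l) * Suc l"
  assume *: "\<not> ?thesis"
  have simple: "simple_graph G"
    using G by (simp add: Free_def)
  have "finite (?D `` {v})" for v
    using flips_symmetric_finite(3)[OF simple E] by (rule finite_Image)
  then obtain f where f: "inj_on f {..?R}" "\<forall>i\<le>?R. \<forall>j\<le>?R. (f i, f j) \<in> ?D \<longleftrightarrow> consecutive i j"
    using large_component_induced_path[OF flips_symmetric_finite(1,2)[OF simple E], where d = d and R = ?R] deg *
    by (metis not_le)
  \<comment> \<open>The path has one vertex more than is used, so each used vertex has a successor
    and therefore lies outside \<open>W\<close>.\<close>
  have f_in: "f i \<in> verts G - W" if "i < ?R" for i
  proof -
    have "(f i, f (Suc i)) \<in> ?D"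
      using f(2) that by (simp add: consecutive_def)
    then show ?thesis
      by (auto simp: flips_def)
  qed
  have "(c \<circ> f) ` {..<?R} \<subseteq> {..<s}"
    using f_in c by auto
  from strip_of_long_word[OF this E lessI l(1)]
  obtain E' where E': "loop_graph_on {1..l} E'"
    "induced_sub (strip l E' m) (GwH (c \<circ> f) E {..<?R})"
    by (elim exE conjE)
  have "induced_sub (GwH (c \<circ> f) E {..<?R}) G"
    unfolding induced_sub_def verts_GwH
  proof (intro exI[of _ f] conjI ballI)
    show "inj_on f {..<?R}"
      using f(1) by (rule inj_on_subset) auto
    show "f ` {..<?R} \<subseteq> verts G"
      using f_in by auto
  next
    fix i j assume ij: "i \<in> {..<?R}" "j \<in> {..<?R}"
    have "(f i, f j) \<in> ?D \<longleftrightarrow> consecutive i j"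
      using f(2) ij by simp
    moreover have "(f i, f j) \<in> ?D \<longleftrightarrow> f i \<noteq> f j \<and> ((f i, f j) \<in> edges G) \<noteq> ((c (f i), c (f j)) \<in> E)"
      using f_in ij by (auto simp: flips_def)
    moreover have "f i = f j \<longleftrightarrow> i = j"
      using inj_on_eq_iff[OF f(1)] ij by simp
    moreover have "(f i, f i) \<notin> edges G"
      using simple by (auto simp: simple_graph_def irrefl_def)
    ultimately show "(i, j) \<in> edges (GwH (c \<circ> f) E {..<?R}) \<longleftrightarrow> (f i, f j) \<in> edges G"
      using ij by (auto simp: edges_GwH)
  qed
  then have "contains_graph (Free Fs) (strip l E' m)"
    using E'(2) G contains_graph_Free_iff induced_sub_trans by blast
  with l(2)[OF E'(1)] show False ..
qed

section \<open>Counting graphs with bounded flip components\<close>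

text \<open>There are at most \<open>2 ^ n\<close> choices for the set of fixed points, and each of
  the at most \<open>n - n div B\<close> other points has at most \<open>n\<close> images.\<close>

lemma card_representatives:
  assumes "B > 0"
  shows "card {\<rho> \<in> {1..n} \<rightarrow>\<^sub>E {1..n}. n \<le> card {v \<in> {1..n}. \<rho> v = v} * B} \<le> 2 ^ n * n ^ (n - n div B)"
    (is "card ?R \<le> _")
proof -
  define \<F> where "\<F> = {F \<in> Pow {1..n}. n \<le> card F * B}"
  define P where "P F = (\<Pi>\<^sub>E v\<in>{1..n}. if v \<in> F then {v} else {1..n})" for F :: "nat set"
  have fin: "finite \<F>"
    by (simp add: \<F>_def)
  have "?R \<subseteq> (\<Union>F\<in>\<F>. P F)"
  proof
    fix \<rho> assume \<rho>: "\<rho> \<in> ?R"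
    let ?F = "{v \<in> {1..n}. \<rho> v = v}"
    have "?F \<in> \<F>"
      using \<rho> by (auto simp: \<F>_def)
    moreover have "\<rho> \<in> P ?F"
      using \<rho> by (auto simp: P_def PiE_iff extensional_def)
    ultimately show "\<rho> \<in> (\<Union>F\<in>\<F>. P F)"
      by blast
  qed
  moreover have "finite (P F)" for F
    by (auto simp: P_def intro!: finite_PiE)
  ultimately have "card ?R \<le> card (\<Union>F\<in>\<F>. P F)"
    using fin by (intro card_mono) auto
  also have "\<dots> \<le> (\<Sum>F\<in>\<F>. card (P F))"
    by (rule card_UN_le[OF fin])
  also have "\<dots> \<le> (\<Sum>F\<in>\<F>. n ^ (n - n div B))"
  proof (rule sum_mono)
    fix F assume "F \<in> \<F>"
    then have F: "F \<subseteq> {1..n}" "n \<le> card F * B"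
      by (auto simp: \<F>_def)
    have "card (P F) = (\<Prod>v\<in>{1..n}. if v \<in> F then 1 else n)"
      unfolding P_def by (subst card_PiE) (auto intro: prod.cong)
    also have "\<dots> = n ^ card ({1..n} - F)"
      by (subst prod.If_cases) (auto simp: set_diff_eq Int_def)
    also have "card ({1..n} - F) = n - card F"
      using F(1) by (simp add: card_Diff_subset finite_subset)
    also have "n ^ (n - card F) \<le> n ^ (n - n div B)"
    proof (cases "n = 0")
      case False
      have "n div B \<le> card F"
        using div_le_mono[OF F(2), of B] assms by simp
      then show ?thesis
        using False by (intro power_increasing) auto
    qed simp
    finally show "card (P F) \<le> n ^ (n - n div B)" .
  qed
  also have "\<dots> = card \<F> * n ^ (n - n div B)"
    by simp
  also have "\<dots> \<le> 2 ^ n * n ^ (n - n div B)"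
  proof (rule mult_le_mono1)
    have "card \<F> \<le> card (Pow {1..n})"
      by (intro card_mono) (auto simp: \<F>_def)
    then show "card \<F> \<le> 2 ^ n"
      by (simp add: card_Pow)
  qed
  finally show ?thesis .
qed

text \<open>A list of fixed length \<open>C\<close> makes the number of choices for the exceptional
  vertices polynomial in \<open>n\<close>.\<close>

lemma enumerate_padded:
  fixes W :: "nat set"
  assumes "finite W" "card W \<le> C"
  shows "\<exists>\<omega>\<in>{..<C} \<rightarrow>\<^sub>E insert 0 W. W \<subseteq> \<omega> ` {..<C}"
proof -
  obtain h where h: "bij_betw h {0..<card W} W"
    using ex_bij_betw_nat_finite[OF assms(1)] by blast
  define \<omega> where "\<omega> = (\<lambda>i\<in>{..<C}. if i < card W then h i else 0)"
  have "\<omega> \<in> {..<C} \<rightarrow>\<^sub>E insert 0 W"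
    using bij_betw_apply[OF h] by (auto simp: \<omega>_def)
  moreover have "W \<subseteq> \<omega> ` {..<C}"
  proof
    fix v assume "v \<in> W"
    then obtain i where "i < card W" "v = h i"
      using bij_betw_imp_surj_on[OF h] by force
    then show "v \<in> \<omega> ` {..<C}"
      using assms(2) by (intro image_eqI[of _ _ i]) (auto simp: \<omega>_def)
  qed
  ultimately show ?thesis
    by blast
qed

text \<open>A relation with components of size at most \<open>B\<close> is encoded by the minimum of the component of
  each vertex, the rank of the vertex in its component and the ranks of its neighbours.\<close>

lemma encode_components:
  fixes D :: "(nat \<times> nat) set"
  assumes sym: "sym D" and D: "D \<subseteq> V \<times> V" and V: "V \<subseteq> {1..n}"
    and comp: "\<And>v. finite (D\<^sup>* `` {v})" "\<And>v. card (D\<^sup>* `` {v}) \<le> B"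
  shows "\<exists>\<rho> idx nb. \<rho> \<in> {1..n} \<rightarrow>\<^sub>E {1..n} \<and> n \<le> card {v \<in> {1..n}. \<rho> v = v} * B \<and>
    (\<forall>v. idx v < B \<and> nb v \<subseteq> {..<B}) \<and>
    (\<forall>u\<in>{1..n}. \<forall>v\<in>{1..n}. (u, v) \<in> D \<longleftrightarrow> \<rho> u = \<rho> v \<and> idx u \<in> nb v)"
proof -
  define c where "c v = D\<^sup>* `` {v}" for v
  have sym_c: "sym (D\<^sup>*)"
    using sym by (rule sym_rtrancl)
  have c_self: "v \<in> c v" for v
    by (simp add: c_def)
  have c_fin: "finite (c v)" for v
    using comp by (simp add: c_def)
  have c_eq: "c u = c v" if "u \<in> c v" for u v
  proof -
    have "(v, u) \<in> D\<^sup>*"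
      using that by (simp add: c_def)
    moreover from this have "(u, v) \<in> D\<^sup>*"
      by (rule symD[OF sym_c])
    ultimately show ?thesis
      by (auto simp: c_def intro: rtrancl_trans)
  qed
  have c_sub: "c v \<subseteq> {1..n}" if "v \<in> {1..n}" for v
  proof
    fix u assume "u \<in> c v"
    then have "(v, u) \<in> D\<^sup>*"
      by (simp add: c_def)
    then show "u \<in> {1..n}"
      using that D V by (induction rule: rtrancl_induct) auto
  qed
  define r where "r v = Min (c v)" for v
  have r_in: "r v \<in> c v" for v
    unfolding r_def using c_fin c_self by (intro Min_in) auto
  have r_eq: "r u = r v \<longleftrightarrow> c u = c v" for u v
  proof
    assume "r u = r v"
    then show "c u = c v"
      using c_eq[OF r_in[of u]] c_eq[OF r_in[of v]] by simp
  qed (simp add: r_def)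
  define \<rho> where "\<rho> = restrict r {1..n}"
  define idx where "idx v = card {u \<in> c v. u < v}" for v
  define nb where "nb v = idx ` (D `` {v})" for v
  have idx_lt: "idx v < B" for v
  proof -
    have "{u \<in> c v. u < v} \<subset> c v"
      using c_self by blast
    then have "idx v < card (c v)"
      unfolding idx_def using c_fin by (intro psubset_card_mono)
    with comp(2)[of v] show ?thesis
      by (simp add: c_def)
  qed
  have idx_mono: "idx u < idx v" if "c u = c v" "u < v" for u v
  proof -
    have "{x \<in> c u. x < u} \<subset> {x \<in> c v. x < v}"
      using that c_self[of u] by fastforce
    then show ?thesis
      unfolding idx_def using c_fin by (intro psubset_card_mono) auto
  qed
  have idx_inj: "u = v" if "c u = c v" "idx u = idx v" for u v
    using idx_mono[of u v] idx_mono[of v u] that by (metis less_irrefl nat_neq_iff)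
  have D_iff: "(u, v) \<in> D \<longleftrightarrow> r u = r v \<and> idx u \<in> nb v" for u v
  proof
    assume "(u, v) \<in> D"
    then have "(v, u) \<in> D"
      using sym by (blast dest: symD)
    then show "r u = r v \<and> idx u \<in> nb v"
      using c_eq[of u v] by (auto simp: r_eq nb_def c_def)
  next
    assume *: "r u = r v \<and> idx u \<in> nb v"
    then obtain u' where u': "(v, u') \<in> D" "idx u = idx u'"
      by (auto simp: nb_def)
    then have "c u' = c v"
      by (intro c_eq) (auto simp: c_def)
    then have "u = u'"
      using * u'(2) r_eq idx_inj by metis
    then show "(u, v) \<in> D"
      using u'(1) sym by (blast dest: symD)
  qed
  have \<rho>_range: "\<rho> \<in> {1..n} \<rightarrow>\<^sub>E {1..n}"
    using r_in c_sub by (fastforce simp: \<rho>_def)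
  \<comment> \<open>The fixed points of \<open>\<rho>\<close> are the minima of the components,
    whose sizes are at most \<open>B\<close> and which together cover all vertices.\<close>
  let ?F = "{v \<in> {1..n}. \<rho> v = v}"
  have "{1..n} \<subseteq> (\<Union>x\<in>?F. c x)"
  proof
    fix v assume v: "v \<in> {1..n}"
    have "r v \<in> {1..n}" "c (r v) = c v"
      using r_in[of v] c_sub[OF v] c_eq[OF r_in] by auto
    moreover from this have "r (r v) = r v"
      by (simp add: r_def)
    ultimately show "v \<in> (\<Union>x\<in>?F. c x)"
      using c_self[of v] by (intro UN_I[of "r v"]) (auto simp: \<rho>_def)
  qed
  then have "card {1..n} \<le> card (\<Union>x\<in>?F. c x)"
    using c_fin by (intro card_mono) auto
  also have "\<dots> \<le> (\<Sum>x\<in>?F. card (c x))"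
    by (rule card_UN_le) simp
  also have "\<dots> \<le> card ?F * B"
    using sum_bounded_above[of ?F "\<lambda>x. card (c x)" B] comp(2) by (simp add: c_def)
  finally have "n \<le> card ?F * B"
    by simp
  moreover have "\<forall>v. idx v < B \<and> nb v \<subseteq> {..<B}"
    using idx_lt by (auto simp: nb_def)
  moreover have "\<forall>u\<in>{1..n}. \<forall>v\<in>{1..n}. (u, v) \<in> D \<longleftrightarrow> \<rho> u = \<rho> v \<and> idx u \<in> nb v"
    using D_iff by (simp add: \<rho>_def)
  ultimately show ?thesis
    using \<rho>_range by (intro exI[of _ \<rho>] exI[of _ idx] exI[of _ nb]) simp
qed

text \<open>The list \<open>\<omega>\<close> enumerates the exceptional vertices, padded with the non-vertex 0; \<open>q v\<close> consists of the
  adjacencies of \<open>v\<close> to that list, its colour, its rank and the ranks of its flip neighbours; \<open>\<rho> v\<close> is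
  the minimum of its flip component.\<close>

definition decode :: "nat \<Rightarrow> nat \<Rightarrow> (nat \<Rightarrow> nat) \<times> (nat \<times> nat) set \<times>
    (nat \<Rightarrow> nat set \<times> nat \<times> nat \<times> nat set) \<times> (nat \<Rightarrow> nat) \<Rightarrow> nat graph" where
  "decode n C = (\<lambda>(\<omega>, E, q, \<rho>). ({1..n}, {(u, v). u \<in> {1..n} \<and> v \<in> {1..n} \<and> u \<noteq> v \<and>
     (if v \<in> \<omega> ` {..<C} then v \<in> \<omega> ` fst (q u)
      else if u \<in> \<omega> ` {..<C} then u \<in> \<omega> ` fst (q v)
      else ((fst (snd (q u)), fst (snd (q v))) \<in> E) \<noteq>
        (\<rho> u = \<rho> v \<and> fst (snd (snd (q u))) \<in> snd (snd (snd (q v)))))}))"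

lemma verts_decode: "verts (decode n C (\<omega>, E, q, \<rho>)) = {1..n}"
  by (simp add: decode_def verts_def)

lemma edges_decode:
  "(u, v) \<in> edges (decode n C (\<omega>, E, q, \<rho>)) \<longleftrightarrow> u \<in> {1..n} \<and> v \<in> {1..n} \<and> u \<noteq> v \<and>
     (if v \<in> \<omega> ` {..<C} then v \<in> \<omega> ` fst (q u)
      else if u \<in> \<omega> ` {..<C} then u \<in> \<omega> ` fst (q v)
      else ((fst (snd (q u)), fst (snd (q v))) \<in> E) \<noteq>
        (\<rho> u = \<rho> v \<and> fst (snd (snd (q u))) \<in> snd (snd (snd (q v)))))"
  by (simp add: decode_def edges_def)

text \<open>Exceptional vertices and the colour relation cost a polynomial and a constant factor,
  the local data \<open>q\<close> an exponential one. Only \<open>\<rho>\<close> costs a power of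
  \<open>n\<close> with linear exponent, and there the bound on the components saves the fraction
  \<open>1 / B\<close>.\<close>

lemma speed_le_of_flip_components:
  assumes "B > 0"
    and flips: "\<And>G. G \<in> Free Fs \<Longrightarrow> verts G = {1..n} \<Longrightarrow>
      \<exists>W c E. W \<subseteq> verts G \<and> card W \<le> C \<and> c ` verts G \<subseteq> {..<s} \<and> loop_graph_on {..<s} E \<and>
        (\<forall>v. finite ((flips G W c E)\<^sup>* `` {v}) \<and> card ((flips G W c E)\<^sup>* `` {v}) \<le> B)"
  shows "speed (Free Fs) n \<le>
    Suc n ^ C * (2 ^ (s * s) * ((2 ^ C * (s * (B * 2 ^ B))) ^ n * (2 ^ n * n ^ (n - n div B))))"
proof -
  define R where "R = {\<rho> \<in> {1..n} \<rightarrow>\<^sub>E {1..n}. n \<le> card {v \<in> {1..n}. \<rho> v = v} * B}"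
  define Q where "Q = Pow {..<C} \<times> {..<s} \<times> {..<B} \<times> Pow {..<B}"
  define codes where "codes = ({..<C} \<rightarrow>\<^sub>E {0..n}) \<times> Pow ({..<s} \<times> {..<s}) \<times> ({1..n} \<rightarrow>\<^sub>E Q) \<times> R"
  have "finite R"
    unfolding R_def by (rule finite_subset[OF _ finite_PiE[of "{1..n}" "\<lambda>_. {1..n}"]]) auto
  then have fin: "finite codes"
    unfolding codes_def Q_def by (intro finite_cartesian_product finite_PiE) auto
  have "{G \<in> Free Fs. verts G = {1..n}} \<subseteq> decode n C ` codes"
  proof
    fix G assume "G \<in> {G \<in> Free Fs. verts G = {1..n}}"
    then have G: "G \<in> Free Fs" "verts G = {1..n}"
      by auto
    then have simple: "simple_graph G"
      by (simp add: Free_def)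
    then have adj: "(u, v) \<in> edges G \<Longrightarrow> u \<in> {1..n} \<and> v \<in> {1..n} \<and> u \<noteq> v"
      and adj_sym: "(u, v) \<in> edges G \<longleftrightarrow> (v, u) \<in> edges G" for u v
      using G(2) by (auto simp: simple_graph_def irrefl_def sym_def)
    obtain W c E where W: "W \<subseteq> {1..n}" "card W \<le> C" and c: "c ` {1..n} \<subseteq> {..<s}"
      and E: "loop_graph_on {..<s} E"
      and comp: "\<forall>v. finite ((flips G W c E)\<^sup>* `` {v}) \<and> card ((flips G W c E)\<^sup>* `` {v}) \<le> B"
      using flips[OF G] unfolding G(2) by (elim exE conjE)
    let ?D = "flips G W c E"
    have D: "?D \<subseteq> ({1..n} - W) \<times> ({1..n} - W)"
      by (auto simp: flips_def G(2))
    obtain \<rho> idx nb where \<rho>: "\<rho> \<in> {1..n} \<rightarrow>\<^sub>E {1..n}" "n \<le> card {v \<in> {1..n}. \<rho> v = v} * B"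
      and nb: "\<forall>v. idx v < B \<and> nb v \<subseteq> {..<B}"
      and D_iff: "\<forall>u\<in>{1..n}. \<forall>v\<in>{1..n}. (u, v) \<in> ?D \<longleftrightarrow> \<rho> u = \<rho> v \<and> idx u \<in> nb v"
      using encode_components[OF flips_symmetric_finite(1)[OF simple E] D Diff_subset conjunct1 conjunct2, OF
          comp[rule_format] comp[rule_format]] by (elim exE conjE)
    have "finite W"
      using W(1) finite_subset by blast
    then obtain \<omega> where \<omega>: "\<omega> \<in> {..<C} \<rightarrow>\<^sub>E insert 0 W" "W \<subseteq> \<omega> ` {..<C}"
      using enumerate_padded[OF _ W(2)] by blast
    \<comment> \<open>The filler 0 is not among the vertices 1 to \<open>n\<close>, so padding adds
      no exceptional vertex.\<close>
    have \<omega>_iff: "v \<in> \<omega> ` {..<C} \<longleftrightarrow> v \<in> W" if "v \<in> {1..n}" for v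
    proof
      assume "v \<in> \<omega> ` {..<C}"
      then obtain i where "i \<in> {..<C}" "v = \<omega> i"
        by blast
      with that PiE_mem[OF \<omega>(1) this(1)] show "v \<in> W"
        by simp
    qed (use \<omega>(2) in blast)
    define row where "row v = {i. i < C \<and> (v, \<omega> i) \<in> edges G}" for v
    define q where "q = (\<lambda>v\<in>{1..n}. (row v, c v, idx v, nb v))"
    have row_iff: "v \<in> \<omega> ` row u \<longleftrightarrow> (u, v) \<in> edges G" if "v \<in> W" for u v
      using \<omega>(2) that by (auto simp: row_def)
    have "(\<omega>, E, q, \<rho>) \<in> codes"
    proof -
      have "({..<C} \<rightarrow>\<^sub>E insert 0 W) \<subseteq> ({..<C} \<rightarrow>\<^sub>E {0..n})"
        using W(1) by (intro PiE_mono) auto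
      with \<omega>(1) have "\<omega> \<in> {..<C} \<rightarrow>\<^sub>E {0..n}"
        by blast
      moreover have "q \<in> {1..n} \<rightarrow>\<^sub>E Q"
        using c nb by (auto simp: q_def Q_def row_def)
      ultimately show ?thesis
        using \<rho> E by (simp add: codes_def R_def loop_graph_on_def)
    qed
    moreover have "G = decode n C (\<omega>, E, q, \<rho>)"
    proof -
      have edges_G: "(u, v) \<in> edges G \<longleftrightarrow> u \<in> {1..n} \<and> v \<in> {1..n} \<and> u \<noteq> v \<and>
       (if v \<in> \<omega> ` {..<C} then v \<in> \<omega> ` row u else if u \<in> \<omega> ` {..<C} then u \<in> \<omega> ` row v
        else ((c u, c v) \<in> E) \<noteq> (\<rho> u = \<rho> v \<and> idx u \<in> nb v))" for u v
      proof (cases "u \<in> {1..n} \<and> v \<in> {1..n} \<and> u \<noteq> v")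
        case True
        then have uv: "u \<in> {1..n}" "v \<in> {1..n}" "u \<noteq> v"
          by auto
        consider "v \<in> W" | "v \<notin> W" "u \<in> W" | "v \<notin> W" "u \<notin> W"
          by blast
        then show ?thesis
        proof cases
          case 1
          then show ?thesis
            using uv \<omega>_iff[OF uv(2)] row_iff by simp
        next
          case 2
          then show ?thesis
            using uv \<omega>_iff[OF uv(1)] \<omega>_iff[OF uv(2)] row_iff adj_sym[of u v] by simp
        next
          case 3
          have "(u, v) \<in> ?D \<longleftrightarrow> ((u, v) \<in> edges G) \<noteq> ((c u, c v) \<in> E)"
            using 3 uv by (simp add: flips_def G(2))
          then have "(u, v) \<in> edges G \<longleftrightarrow> ((c u, c v) \<in> E) \<noteq> (\<rho> u = \<rho> v \<and> idx u \<in> nb v)"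
            using D_iff uv(1,2) by blast
          then show ?thesis
            using 3 uv \<omega>_iff[OF uv(1)] \<omega>_iff[OF uv(2)] by simp
        qed
      next
        case False
        then show ?thesis
          using adj[of u v] by blast
      qed
      have "(u, v) \<in> edges G \<longleftrightarrow> (u, v) \<in> edges (decode n C (\<omega>, E, q, \<rho>))" for u v
        unfolding edges_decode edges_G[of u v] by (auto simp: q_def)
      then have "edges G = edges (decode n C (\<omega>, E, q, \<rho>))"
        by auto
      moreover have "verts G = verts (decode n C (\<omega>, E, q, \<rho>))"
        by (simp add: G(2) verts_decode)
      ultimately show ?thesis
        by (simp add: edges_def verts_def prod_eq_iff)
    qed
    ultimately show "G \<in> decode n C ` codes"
      by blast
  qed
  then have "speed (Free Fs) n \<le> card codes"
    unfolding speed_def by (rule surj_card_le[OF fin])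
  also have "card codes = Suc n ^ C * (2 ^ (s * s) * ((2 ^ C * (s * (B * 2 ^ B))) ^ n * card R))"
    by (simp add: codes_def Q_def card_cartesian_product card_PiE card_Pow)
  also have "\<dots> \<le> Suc n ^ C * (2 ^ (s * s) * ((2 ^ C * (s * (B * 2 ^ B))) ^ n * (2 ^ n * n ^ (n - n div B))))"
    unfolding R_def by (intro mult_le_mono2 card_representatives[OF assms(1)])
  finally show ?thesis .
qed

text \<open>Divided by \<open>n * ln n\<close>, the logarithm of the bound tends to
  \<open>1 - 1 / B\<close>. This contradicts the lower bound for \<open>\<epsilon>\<close> equal to
  \<open>1 / (2 * B)\<close>.\<close>

lemma not_above_Bell_of_bound:
  fixes B C K P :: nat
  assumes "B > 0" "K > 0" "P > 0"
    and bound: "\<And>n. speed X n \<le> Suc n ^ C * (P * (K ^ n * (2 ^ n * n ^ (n - n div B))))"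
  shows "\<not> above_Bell X"
proof
  assume "above_Bell X"
  define b where "b = real B"
  have b: "b > 0"
    using assms(1) by (simp add: b_def)
  have "\<forall>\<^sub>F n in sequentially. real n powr ((1 - 1 / (2 * b)) * real n) \<le> real (speed X n)"
    using \<open>above_Bell X\<close> b unfolding above_Bell_iff by simp
  moreover define g where "g x = (C * ln (x + 1) + ln P + x * ln K + x * ln 2 + (x - x / b + 1) * ln x) / (x * ln x)" for x
  have "(g \<longlongrightarrow> 1 - inverse b) at_top"
    unfolding g_def using b by real_asymp
  then have "\<forall>\<^sub>F x in at_top. g x < 1 - 1 / (2 * b)"
    by (rule order_tendstoD(2)) (use b in \<open>simp add: field_simps\<close>)
  from eventually_compose_filterlim[OF this filterlim_real_sequentially]
  have "\<forall>\<^sub>F n in sequentially. g (real n) < 1 - 1 / (2 * b)" .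
  ultimately have "\<forall>\<^sub>F n :: nat in sequentially. False"
    using eventually_ge_at_top[of "2::nat"]
  proof eventually_elim
    case (elim n)
    have n: "real n * ln (real n) > 0"
      using elim by simp
    \<comment> \<open>Rounding in the integer quotient costs at most 1 in the exponent, the summand
      1 in \<open>g\<close>.\<close>
    have "n < (n div B + 1) * B"
      using dividend_less_div_times[OF assms(1), of n] by (simp add: algebra_simps)
    then have "real n < (real (n div B) + 1) * b"
      unfolding b_def by (metis of_nat_1 of_nat_add of_nat_less_iff of_nat_mult)
    then have "real (n - n div B) \<le> real n - real n / b + 1"
      using b by (simp add: field_simps)
    then have exponent: "real (n - n div B) * ln (real n) \<le> (real n - real n / b + 1) * ln (real n)"
      using elim by (intro mult_right_mono) auto
    let ?bound = "real (Suc n) ^ C * (real P * (real K ^ n * (2 ^ n * real n ^ (n - n div B))))"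
    have "real (speed X n) \<le> real (Suc n ^ C * (P * (K ^ n * (2 ^ n * n ^ (n - n div B)))))"
      using bound by (simp only: of_nat_le_iff)
    then have "real n powr ((1 - 1 / (2 * b)) * real n) \<le> ?bound"
      using elim(1) by (simp del: of_nat_Suc)
    then have "ln (real n powr ((1 - 1 / (2 * b)) * real n)) \<le> ln ?bound"
      using elim assms by (subst ln_le_cancel_iff) auto
    also have "ln ?bound = C * ln (real n + 1) + ln P + real n * ln K + real n * ln 2
        + real (n - n div B) * ln (real n)"
      using elim assms by (simp add: ln_mult ln_realpow add.commute del: of_nat_diff)
    also have "\<dots> \<le> C * ln (real n + 1) + ln P + real n * ln K + real n * ln 2
        + (real n - real n / b + 1) * ln (real n)"
      by (intro add_left_mono exponent)
    also have "\<dots> = g (real n) * (real n * ln (real n))"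
    proof -
      have "real n * ln (real n) \<noteq> 0"
        using n by linarith
      then show ?thesis
        unfolding g_def by (rule nonzero_divide_eq_eq[THEN iffD1]) (rule refl)
    qed
    also have "\<dots> < (1 - 1 / (2 * b)) * (real n * ln (real n))"
      using elim n by (intro mult_strict_right_mono) auto
    finally show False
      using elim by (simp add: mult.assoc)
  qed
  then show False
    by simp
qed

lemma strips_of_above_Bell:
  assumes kfin: "\<not> k_infinite (Free Fs)" and bell: "above_Bell (Free Fs)"
    and l: "l > 0"
  shows "\<exists>E. loop_graph_on {1..l} E \<and> contains_graph (Free Fs) (strip l E m)"
proof (rule ccontr)
  assume "\<not> ?thesis"
  then have no_strip: "\<not> contains_graph (Free Fs) (strip l E m)" if "loop_graph_on {1..l} E" for E
    using that by blast
  obtain k M where k: "k > 0"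
    "\<And>G S U. G \<in> Free Fs \<Longrightarrow> distinguishes G S U M \<Longrightarrow> \<exists>i<M. card (U i) < k"
    using k_finite_bound[OF kfin] by blast
  \<comment> \<open>\<open>s\<close> bounds the number of colours, \<open>d\<close> the flip degree,
    \<open>C\<close> the number of exceptional vertices and \<open>B\<close> the component sizes,
    uniformly over the class and in \<open>n\<close>.\<close>
  define s :: nat where "s = 4 ^ M"
  define d where "d = M * (2 ^ M * k)"
  define C where "C = s * (2 * (2 ^ M * k))"
  define B where "B = Suc d ^ (Suc (m * s ^ l) * Suc l)"
  have B: "B > 0"
    by (simp add: B_def)
  have "\<exists>W c E. W \<subseteq> verts G \<and> card W \<le> C \<and> c ` verts G \<subseteq> {..<s} \<and> loop_graph_on {..<s} E \<and>
      (\<forall>v. finite ((flips G W c E)\<^sup>* `` {v}) \<and> card ((flips G W c E)\<^sup>* `` {v}) \<le> B)"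
    if G: "G \<in> Free Fs" for G
  proof -
    have "simple_graph G"
      using G by (simp add: Free_def)
    moreover have "\<forall>S U. distinguishes G S U M \<longrightarrow> (\<exists>i<M. card (U i) < k)"
      using k(2)[OF G] by blast
    ultimately obtain W c E where W: "W \<subseteq> verts G" "card W \<le> C" and c: "c ` verts G \<subseteq> {..<s}"
      and E: "loop_graph_on {..<s} E" and deg: "\<forall>v. card (flips G W c E `` {v}) \<le> d"
      using flip_structure[OF _ k(1), of G M, folded s_def, folded C_def d_def] by blast
    have "finite ((flips G W c E)\<^sup>* `` {v}) \<and> card ((flips G W c E)\<^sup>* `` {v}) \<le> B" for v
      unfolding B_def by (rule bounded_flip_components[OF G E c deg l no_strip])
    with W c E show ?thesis
      by blast
  qed
  then have "speed (Free Fs) n \<le>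
      Suc n ^ C * (2 ^ (s * s) * ((2 ^ C * (s * (B * 2 ^ B))) ^ n * (2 ^ n * n ^ (n - n div B))))" for n
    by (intro speed_le_of_flip_components[OF B])
  then have "\<not> above_Bell (Free Fs)"
    by (intro not_above_Bell_of_bound[OF B, of "2 ^ C * (s * (B * 2 ^ B))" "2 ^ (s * s)"])
      (simp_all add: B s_def)
  with bell show False
    by contradiction
qed

section \<open>The equivalence of the five conditions\<close>

theorem theorem4p6:
  fixes Fs :: "nat graph list"
  assumes graphs: "\<forall>F\<in>set Fs. simple_graph F"
    and kfin: "\<not> k_infinite (Free Fs)"
  defines "X \<equiv> Free Fs"
    and "mF \<equiv> Max (insert 0 ((\<lambda>F. card (verts F)) ` set Fs))"
  shows
   "let
      a = above_Bell X;
      b = (\<exists>A E w. word_over A w \<and> loop_graph_on A E \<and> periodic_word w \<and> Pclass w E \<subseteq> X);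
      c = (\<forall>p::nat. \<exists>A E w q. word_over A w \<and> loop_graph_on A E \<and> cyclic_with_period w q
              \<and> q \<ge> p \<and> Pclass w E \<subseteq> X);
      d = (\<exists>A E w q. word_over A w \<and> loop_graph_on A E \<and> cyclic_with_period w q
              \<and> contains_graph X (GwH w E {1..2 * card A * mF}));
      e = (\<forall>l m. l > 0 \<longrightarrow> m > 0 \<longrightarrow>
             (\<exists>E. loop_graph_on {1..l} E \<and> contains_graph X (strip l E m)))
    in (a \<longleftrightarrow> b) \<and> (b \<longleftrightarrow> c) \<and> (c \<longleftrightarrow> d) \<and> (d \<longleftrightarrow> e)"
proof -
  let ?b = "\<exists>A E w. word_over A w \<and> loop_graph_on A E \<and> periodic_word w \<and> Pclass w E \<subseteq> X"
  let ?c = "\<forall>p::nat. \<exists>A E w q. word_over A w \<and> loop_graph_on A E \<and> cyclic_with_period w q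
              \<and> q \<ge> p \<and> Pclass w E \<subseteq> X"
  let ?d = "\<exists>A E w q. word_over A w \<and> loop_graph_on A E \<and> cyclic_with_period w q
              \<and> contains_graph X (GwH w E {1..2 * card A * mF})"
  let ?e = "\<forall>l m. l > 0 \<longrightarrow> m > 0 \<longrightarrow>
             (\<exists>E. loop_graph_on {1..l} E \<and> contains_graph X (strip l E m))"
  \<comment> \<open>Conditions b, c and d form a cycle; e follows from c and implies b, and a is
    exchanged with e directly.\<close>
  have bc: "?b \<Longrightarrow> ?c"
    by (elim exE conjE, intro allI, rule periodic_imp_cyclic)
  have cd: "?d" if *: ?c
  proof -
    obtain A E w q where w: "word_over A w" "loop_graph_on A E" "cyclic_with_period w q" "Pclass w E \<subseteq> X"
      using * by blast
    have "GwH w E {1..2 * card A * mF} \<in> X"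
      using GwH_in_Pclass[OF _ _ w(2)] w(4) by auto
    moreover have "induced_sub (GwH w E U) (GwH w E U)" for U
      unfolding induced_sub_def by (intro exI[of _ id]) simp
    ultimately show ?thesis
      using w unfolding X_def contains_graph_Free_iff by blast
  qed
  have db: "?b" if *: ?d
  proof -
    obtain A E w q where w: "word_over A w" "loop_graph_on A E" "cyclic_with_period w q"
      "contains_graph X (GwH w E {1..2 * card A * mF})"
      using * by blast
    have "Pclass w E \<subseteq> X"
      unfolding X_def
      by (rule Pclass_subset_of_long_prefix[OF w(1-3) w(4)[unfolded X_def mF_def]])
    moreover have "periodic_word w"
      using w(3) by (auto simp: cyclic_with_period_def periodic_word_def)
    ultimately show ?thesis
      using w by blast
  qed
  have ce: "?e" if ?c
  proof (intro allI impI)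
    fix l m :: nat
    obtain A E w q where w: "word_over A w" "loop_graph_on A E" "cyclic_with_period w q" "l \<le> q"
      "Pclass w E \<subseteq> X"
      using \<open>?c\<close> by blast
    then show "\<exists>E. loop_graph_on {1..l} E \<and> contains_graph X (strip l E m)"
      unfolding X_def by (intro strip_in_cyclic_class[OF w(2)]) (auto simp: cyclic_with_period_def)
  qed
  have eb: "?e \<Longrightarrow> ?b"
    unfolding X_def by (rule periodic_class_of_strips[OF kfin]) blast
  have ea: "?e \<Longrightarrow> above_Bell X"
    unfolding X_def by (rule above_Bell_of_strips) blast
  have ae: "above_Bell X \<Longrightarrow> ?e"
    unfolding X_def using strips_of_above_Bell[OF kfin] by blast
  show ?thesis
    unfolding Let_def using bc cd db ce eb ea ae by argo
qed

end
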